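(* Let $d\ge1$ and $k\ge0$. The number of noncrossing partitions $\pi$ of $[dk+1]$ such that every block of $\pi$ has size $1$ or $d+1$ and every block of the Kreweras dual $\pi'$ has size $1$ or $d+1$ is $$\frac{2}{dk+2}\binom{dk+2}{k}.$$ If one further requires that $\{1\}$ is a (singleton) block of $\pi$, the number is $$\frac{1}{dk+1}\binom{dk+1}{k}.$$
   Context: A partition of $[n]$ is noncrossing if there are no $i<j<k<\ell$ with $i,k$ in one block and $j,\ell$ in a different block. The Kreweras dual $\pi'$ of a noncrossing partition $\pi$ of $[n]$: place $1,1',2,2',\dots,n,n'$ on a circle in this cyclic order; $\pi'$ is the coarsest partition of $\{1',\dots,n'\}$ such that the blocks of $\pi$ and of $\pi'$ together form a noncrossing partition of these $2n$ points. *)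

theory Defs
  imports Complex_Main "HOL-Library.Disjoint_Sets"
begin

definition noncrossing :: "nat set set \<Rightarrow> bool" where
  "noncrossing P \<longleftrightarrow>
     \<not> (\<exists>B\<in>P. \<exists>C\<in>P. B \<noteq> C \<and>
          (\<exists>i j k l. i < j \<and> j < k \<and> k < l \<and> i \<in> B \<and> k \<in> B \<and> j \<in> C \<and> l \<in> C))"

definition noncrossing_partitions :: "nat \<Rightarrow> nat set set set" where
  "noncrossing_partitions n = {P. partition_on {1..n} P \<and> noncrossing P}"

text \<open>
  The \<open>2n\<close> points \<open>1, 1', 2, 2', \<dots>, n, n'\<close> on the circle are numbered \<open>1, \<dots>, 2n\<close>, so that
  \<open>i\<close> becomes \<open>2i - 1\<close> and \<open>i'\<close> becomes \<open>2i\<close>. Cutting the circle open between \<open>n'\<close> and \<open>1\<close> does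
  not affect which pairs of blocks cross. A partition of the primed points is represented by
  the corresponding partition \<open>Q\<close> of \<open>{1..n}\<close>, with \<open>i\<close> standing for \<open>i'\<close>.
\<close>

definition circle_blocks :: "nat set set \<Rightarrow> nat set set \<Rightarrow> nat set set" where
  "circle_blocks P Q =
     (\<lambda>B. (\<lambda>i. 2 * i - 1) ` B) ` P \<union> (\<lambda>B. (\<lambda>i. 2 * i) ` B) ` Q"

definition is_kreweras_dual :: "nat \<Rightarrow> nat set set \<Rightarrow> nat set set \<Rightarrow> bool" where
  "is_kreweras_dual n P Q \<longleftrightarrow>
     partition_on {1..n} Q \<and> noncrossing (circle_blocks P Q) \<and>
     (\<forall>R. partition_on {1..n} R \<and> noncrossing (circle_blocks P R) \<longrightarrow> refines {1..n} R Q)"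

text \<open>
  The description is meaningful for \<open>P \<in> noncrossing_partitions n\<close>: the coarsest such \<open>Q\<close> is a
  greatest element with respect to refinement, hence unique.
\<close>

definition kreweras_dual :: "nat \<Rightarrow> nat set set \<Rightarrow> nat set set" where
  "kreweras_dual n P = (THE Q. is_kreweras_dual n P Q)"

end

theory Submission
  imports Defs "HOL-Computational_Algebra.Formal_Power_Series"
begin

text \<open>
  Noncrossing partitions of \<open>{1..n}\<close> are treated as noncrossing equivalence relations \<open>r\<close>. In the
  Kreweras dual, \<open>i\<close> and \<open>j\<close> are related iff the interval between the cuts at \<open>i'\<close> and \<open>j'\<close> is
  a union of classes of \<open>r\<close>. Composed with the reflection \<open>i \<mapsto> n + 1 - i\<close>, duality is an
  involution.

  Let \<open>a(t, n)\<close> count the \<open>r\<close> for which the dual class of \<open>n\<close> has \<open>t\<close> elements and all other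
  classes of \<open>r\<close> and of its dual have size \<open>1\<close> or \<open>d + 1\<close>. The dual class of \<open>n\<close> consists of the
  \<open>c\<close> such that \<open>{1..c}\<close> is a union of classes, so \<open>r\<close> is a direct sum of \<open>t\<close> indecomposable
  pieces. A piece with \<open>n + 1 > 1\<close> points has \<open>1\<close> and \<open>n + 1\<close> in one class of size \<open>d + 1\<close>;
  removing \<open>n + 1\<close> leaves a relation in which the class of \<open>1\<close> has size \<open>d\<close>, and duality turns it
  into one counted by \<open>a(d, n)\<close>. In generating functions this gives
  \<open>a(t + 1, n + 1) = a(t, n) + a(t + d, n)\<close>, which is solved by
  \<open>a(t, d k + t) = t / (d k + t) * ((d k + t) choose k)\<close>. The partitions in question are counted by
  \<open>a(1, n) + a(d + 1, n) = a(2, n + 1)\<close>, and those with the block \<open>{1}\<close> by \<open>a(1, n)\<close>.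
\<close>

section \<open>Noncrossing equivalence relations and duality\<close>

definition noncrossing_rel :: "(nat \<times> nat) set \<Rightarrow> bool" where
  "noncrossing_rel r \<longleftrightarrow>
     (\<forall>i j k l. i < j \<and> j < k \<and> k < l \<and> (i, k) \<in> r \<and> (j, l) \<in> r \<longrightarrow> (i, j) \<in> r)"

definition nc_equiv :: "nat \<Rightarrow> (nat \<times> nat) set set" where
  "nc_equiv n = {r. equiv {1..n} r \<and> noncrossing_rel r}"

text \<open>
  The condition says that the points between \<open>i'\<close> and \<open>j'\<close> form a union of classes of \<open>r\<close>: both
  sides compare whether a pair of \<open>r\<close> is separated by the cut at \<open>i'\<close> and by the cut at \<open>j'\<close>.
\<close>

definition dual_rel :: "nat \<Rightarrow> (nat \<times> nat) set \<Rightarrow> (nat \<times> nat) set" where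
  "dual_rel n r = {(i, j). i \<in> {1..n} \<and> j \<in> {1..n} \<and>
     (\<forall>(x, y)\<in>r. (i < x \<longleftrightarrow> i < y) \<longleftrightarrow> (j < x \<longleftrightarrow> j < y))}"

lemma nc_equivI:
  assumes "\<And>x y. (x, y) \<in> r \<Longrightarrow> x \<in> {1..n} \<and> y \<in> {1..n}"
    and "\<And>x. x \<in> {1..n} \<Longrightarrow> (x, x) \<in> r"
    and "\<And>x y. (x, y) \<in> r \<Longrightarrow> (y, x) \<in> r"
    and "\<And>x y z. (x, y) \<in> r \<Longrightarrow> (y, z) \<in> r \<Longrightarrow> (x, z) \<in> r"
    and "\<And>i j k l. i < j \<Longrightarrow> j < k \<Longrightarrow> k < l \<Longrightarrow> (i, k) \<in> r \<Longrightarrow> (j, l) \<in> r \<Longrightarrow> (i, j) \<in> r"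
  shows "r \<in> nc_equiv n"
proof -
  have "r \<subseteq> {1..n} \<times> {1..n}"
    using assms(1) by auto
  moreover have "refl_on {1..n} r"
    using assms(2) by (rule refl_onI)
  moreover have "sym r"
    using assms(3) by (rule symI)
  moreover have "trans r"
    using assms(4) by (rule transI)
  moreover have "noncrossing_rel r"
    unfolding noncrossing_rel_def using assms(5) by metis
  ultimately show ?thesis
    unfolding nc_equiv_def equiv_def by simp
qed

lemma nc_equivD:
  assumes "r \<in> nc_equiv n"
  shows nc_equiv_field: "(x, y) \<in> r \<Longrightarrow> x \<in> {1..n} \<and> y \<in> {1..n}"
    and nc_equiv_refl: "x \<in> {1..n} \<Longrightarrow> (x, x) \<in> r"
    and nc_equiv_sym: "(x, y) \<in> r \<Longrightarrow> (y, x) \<in> r"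
    and nc_equiv_trans: "(x, y) \<in> r \<Longrightarrow> (y, z) \<in> r \<Longrightarrow> (x, z) \<in> r"
    and nc_equiv_nc: "i < j \<Longrightarrow> j < k \<Longrightarrow> k < l \<Longrightarrow> (i, k) \<in> r \<Longrightarrow> (j, l) \<in> r \<Longrightarrow> (i, j) \<in> r"
proof -
  have r: "r \<subseteq> {1..n} \<times> {1..n}" "refl_on {1..n} r" "sym r" "trans r" "noncrossing_rel r"
    using assms unfolding nc_equiv_def equiv_def by auto
  show "(x, y) \<in> r \<Longrightarrow> x \<in> {1..n} \<and> y \<in> {1..n}"
    using r(1) by blast
  show "x \<in> {1..n} \<Longrightarrow> (x, x) \<in> r"
    using r(2) by (rule refl_onD)
  show "(x, y) \<in> r \<Longrightarrow> (y, x) \<in> r"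
    using r(3) by (rule symD)
  show "(x, y) \<in> r \<Longrightarrow> (y, z) \<in> r \<Longrightarrow> (x, z) \<in> r"
    using r(4) by (rule transD)
  show "i < j \<Longrightarrow> j < k \<Longrightarrow> k < l \<Longrightarrow> (i, k) \<in> r \<Longrightarrow> (j, l) \<in> r \<Longrightarrow> (i, j) \<in> r"
    using r(5) unfolding noncrossing_rel_def by metis
qed

lemma finite_nc_equiv: "finite (nc_equiv n)"
proof (rule finite_subset)
  show "nc_equiv n \<subseteq> Pow ({1..n} \<times> {1..n})"
    unfolding nc_equiv_def equiv_def by blast
qed simp

lemma finite_class: "r \<in> nc_equiv n \<Longrightarrow> finite (r `` {x})"
  by (rule finite_subset[of _ "{1..n}"]) (auto dest: nc_equiv_field)

lemma dual_relI:
  assumes "i \<in> {1..n}" "j \<in> {1..n}"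
    and "\<And>x y. (x, y) \<in> r \<Longrightarrow> (i < x \<longleftrightarrow> i < y) \<longleftrightarrow> (j < x \<longleftrightarrow> j < y)"
  shows "(i, j) \<in> dual_rel n r"
  using assms unfolding dual_rel_def by blast

lemma dual_relD:
  assumes "(i, j) \<in> dual_rel n r"
  shows "i \<in> {1..n}" "j \<in> {1..n}"
    and "(x, y) \<in> r \<Longrightarrow> (i < x \<longleftrightarrow> i < y) \<longleftrightarrow> (j < x \<longleftrightarrow> j < y)"
  using assms unfolding dual_rel_def by blast+

text \<open>For a fixed pair \<open>(x, y)\<close> of \<open>r\<close>, the cuts separating
  \<open>x\<close> from \<open>y\<close> form an interval, and dual cuts agree on membership in it.
  For \<open>i < j < k < l\<close> with \<open>i, k\<close> and \<open>j, l\<close> agreeing,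
  containing \<open>i\<close> and \<open>k\<close> forces \<open>j\<close>, and containing
  \<open>j\<close> and \<open>l\<close> forces \<open>k\<close>; so \<open>i\<close> and
  \<open>j\<close> agree.\<close>

lemma dual_rel_nc_equiv: "dual_rel n r \<in> nc_equiv n"
proof (rule nc_equivI)
  fix i j k l assume ijkl: "i < j" "j < k" "k < l" and ik: "(i, k) \<in> dual_rel n r"
    and jl: "(j, l) \<in> dual_rel n r"
  show "(i, j) \<in> dual_rel n r"
  proof (rule dual_relI)
    fix x y assume xy: "(x, y) \<in> r"
    show "(i < x \<longleftrightarrow> i < y) \<longleftrightarrow> (j < x \<longleftrightarrow> j < y)"
      using dual_relD(3)[OF ik xy] dual_relD(3)[OF jl xy] ijkl by linarith
  qed (use dual_relD[OF ik] dual_relD[OF jl] in auto)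
qed (auto simp: dual_rel_def)

text \<open>
  For the backward direction, walk along the class of \<open>x\<close> to its last element \<open>a\<close> below \<open>y\<close>. The
  next element \<open>a'\<close> of that class, read cyclically, lies outside \<open>{x..<y}\<close>, and \<open>a\<close> is dual to
  \<open>a' - 1\<close>.
\<close>

lemma nc_equiv_bidual:
  assumes r: "r \<in> nc_equiv n" and x: "x \<in> {1..n}" and y: "y \<in> {1..n}"
  shows "(x, y) \<in> r \<longleftrightarrow> (\<forall>(u, v)\<in>dual_rel n r. (u < x \<longleftrightarrow> v < x) \<longleftrightarrow> (u < y \<longleftrightarrow> v < y))"
    (is "_ \<longleftrightarrow> ?B x y")
proof
  show "?B x y" if "(x, y) \<in> r"
    using that unfolding dual_rel_def by blast
  have *: "(x, y) \<in> r" if B: "?B x y" and less: "x < y" and x: "x \<in> {1..n}" and y: "y \<in> {1..n}"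
    for x y
  proof (rule ccontr)
    assume nxy: "(x, y) \<notin> r"
    \<comment> \<open>Regrouping the equivalences, \<open>?B x y\<close> says that dual cuts lie
      both inside or both outside \<open>{x..<y}\<close>.\<close>
    have dual: "\<not> (u \<in> {x..<y} \<and> v \<notin> {x..<y})" if "(u, v) \<in> dual_rel n r" for u v
      using B that less by fastforce
    define a where "a = Max {z. z < y \<and> (x, z) \<in> r}"
    have fin: "finite {z. z < y \<and> (x, z) \<in> r}"
      by (rule finite_subset[of _ "{..<y}"]) auto
    have "a \<in> {z. z < y \<and> (x, z) \<in> r}"
      unfolding a_def by (rule Max_in[OF fin]) (use less nc_equiv_refl[OF r x] in blast)
    then have a: "a < y" "(x, a) \<in> r"
      by auto
    have a_max: "z \<le> a" if "z < y" "(x, z) \<in> r" for z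
      unfolding a_def using fin that by (intro Max_ge) auto
    have xa: "x \<le> a"
      using a_max[OF less nc_equiv_refl[OF r x]] .
    have an: "a \<in> {1..n}"
      using nc_equiv_field[OF r a(2)] by auto
    show False
    proof (cases "\<exists>z>a. (x, z) \<in> r")
      case True
      define b where "b = (LEAST z. a < z \<and> (x, z) \<in> r)"
      have b: "a < b" "(x, b) \<in> r"
        using LeastI_ex[of "\<lambda>z. a < z \<and> (x, z) \<in> r"] True unfolding b_def by auto
      have b_min: "b \<le> z" if "a < z" "(x, z) \<in> r" for z
        unfolding b_def using that by (intro Least_le) auto
      have "y < b"
        using a_max[of b] b nxy by (metis leD linorder_neqE_nat)
      have ab: "(a, b) \<in> r"
        using a b r by (metis nc_equiv_sym nc_equiv_trans)
      have "(a, b - 1) \<in> dual_rel n r"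
      proof (rule dual_relI)
        fix u v assume uv: "(u, v) \<in> r"
        \<comment> \<open>A pair with one point inside the gap between \<open>a\<close> and
          \<open>b\<close> and the other outside would cross the class of \<open>x\<close>, so it
          belongs to that class; but \<open>b\<close> is the first element of the class after
          \<open>a\<close>.\<close>
        have *: "\<not> (a < u \<and> u < b \<and> (v \<le> a \<or> b \<le> v))" if "(u, v) \<in> r" for u v
        proof
          assume H: "a < u \<and> u < b \<and> (v \<le> a \<or> b \<le> v)"
          have "(x, u) \<notin> r"
            using b_min[of u] H by auto
          moreover have "(a, u) \<in> r"
          proof (cases "v = a \<or> v = b")
            case True
            then show ?thesis using that ab r by (metis nc_equiv_sym nc_equiv_trans)
          next
            case False
            then consider "v < a" | "b < v" using H by linarith
            then show ?thesis
            proof cases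
              case 1
              then have "(v, a) \<in> r"
                using nc_equiv_nc[OF r 1, of u b] H ab that nc_equiv_sym[OF r] by blast
              then show ?thesis using that r by (metis nc_equiv_sym nc_equiv_trans)
            next
              case 2
              then show ?thesis
                using nc_equiv_nc[OF r _ _ 2, of a u] H ab that by blast
            qed
          qed
          ultimately show False
            using a(2) r by (metis nc_equiv_trans)
        qed
        show "(a < u \<longleftrightarrow> a < v) \<longleftrightarrow> (b - 1 < u \<longleftrightarrow> b - 1 < v)"
          using *[OF uv] *[OF nc_equiv_sym[OF r uv]] \<open>a < b\<close> by linarith
      qed (use an b nc_equiv_field[OF r b(2)] in auto)
      then show False
        using dual[of a "b - 1"] a xa \<open>y < b\<close> by auto
    next
      case False
      define c where "c = (LEAST z. (x, z) \<in> r)"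
      have c: "(x, c) \<in> r"
        unfolding c_def using a(2) by (rule LeastI)
      have c_min: "c \<le> z" if "(x, z) \<in> r" for z
        unfolding c_def using that by (rule Least_le)
      have ca: "(c, a) \<in> r"
        using a c r by (metis nc_equiv_sym nc_equiv_trans)
      \<comment> \<open>\<open>c\<close> and \<open>a\<close> are the first and last element of the
        class of \<open>x\<close>, so a pair leading out of \<open>{c..a}\<close> would cross that
        class.\<close>
      have hull: "\<not> (c \<le> u \<and> u \<le> a \<and> (v < c \<or> a < v))" if uv: "(u, v) \<in> r" for u v
      proof
        assume H: "c \<le> u \<and> u \<le> a \<and> (v < c \<or> a < v)"
        then have "(x, v) \<notin> r"
          using c_min[of v] False by auto
        then have nu: "(c, u) \<notin> r" "(c, v) \<notin> r"
          using uv c r by (metis nc_equiv_trans)+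
        then have "c < u" "u < a"
          using H ca c nc_equiv_refl[OF r] nc_equiv_field[OF r ca]
          by (metis le_neq_implies_less)+
        consider "v < c" | "a < v"
          using H by auto
        then show False
        proof cases
          case 1
          then show False
            using nc_equiv_nc[OF r 1 \<open>c < u\<close> \<open>u < a\<close>] uv ca nu nc_equiv_sym[OF r] by blast
        next
          case 2
          then show False
            using nc_equiv_nc[OF r \<open>c < u\<close> \<open>u < a\<close>] uv ca nu by blast
        qed
      qed
      show False
      proof (cases "c = 1")
        case True
        \<comment> \<open>Cyclically, the cut before the point 1 is at \<open>n'\<close>; it takes
          the place of \<open>c - 1 = 0\<close>.\<close>
        have "(a, n) \<in> dual_rel n r"
        proof (rule dual_relI)
          fix u v assume uv: "(u, v) \<in> r"
          show "(a < u \<longleftrightarrow> a < v) \<longleftrightarrow> (n < u \<longleftrightarrow> n < v)"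
            using hull[OF uv] hull[OF nc_equiv_sym[OF r uv]] nc_equiv_field[OF r uv] True by auto
        qed (use an in auto)
        then show False
          using dual[of a n] a xa y by auto
      next
        case False
        have "c \<in> {1..n}" "c \<le> x" "c \<le> a"
          using nc_equiv_field[OF r c] c_min[OF nc_equiv_refl[OF r x]] c_min[OF a(2)] by auto
        have "(a, c - 1) \<in> dual_rel n r"
        proof (rule dual_relI)
          fix u v assume uv: "(u, v) \<in> r"
          show "(a < u \<longleftrightarrow> a < v) \<longleftrightarrow> (c - 1 < u \<longleftrightarrow> c - 1 < v)"
            using hull[OF uv] hull[OF nc_equiv_sym[OF r uv]] False \<open>c \<in> _\<close> \<open>c \<le> a\<close> by auto
        qed (use an False \<open>c \<in> _\<close> in auto)
        then show False
          using dual[of a "c - 1"] a xa \<open>c \<le> x\<close> \<open>c \<in> _\<close> False by auto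
      qed
    qed
  qed
  show "(x, y) \<in> r" if "?B x y"
  proof (cases x y rule: linorder_cases)
    case less
    then show ?thesis using * that x y by blast
  next
    case equal
    then show ?thesis using nc_equiv_refl[OF r] x by simp
  next
    case greater
    moreover have "?B y x" using that by blast
    ultimately show ?thesis using * x y nc_equiv_sym[OF r] by blast
  qed
qed

text \<open>Taking the dual twice rotates the points. The reflection
  \<open>p \<mapsto> 2n + 1 - p\<close> of the \<open>2n\<close> circle points exchanges
  \<open>i'\<close> with \<open>n + 1 - i\<close>; transporting the dual along it removes the
  rotation.\<close>

definition flip :: "nat \<Rightarrow> (nat \<times> nat) set \<Rightarrow> (nat \<times> nat) set" where
  "flip n r = {(x, y). x \<in> {1..n} \<and> y \<in> {1..n} \<and> (n + 1 - x, n + 1 - y) \<in> dual_rel n r}"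

lemma reflect_in_range: "x \<in> {1..n} \<Longrightarrow> n + 1 - x \<in> {1..n}" for x n :: nat
  by auto

lemma reflect_reflect: "x \<in> {1..n} \<Longrightarrow> n + 1 - (n + 1 - x) = x" for x n :: nat
  by auto

lemma flip_nc_equiv: "flip n r \<in> nc_equiv n"
proof -
  note D = dual_rel_nc_equiv[of n r]
  show ?thesis
  proof (rule nc_equivI)
    fix i j k l assume ijkl: "i < j" "j < k" "k < l" and ik: "(i, k) \<in> flip n r"
      and jl: "(j, l) \<in> flip n r"
    have "l \<le> n" using jl unfolding flip_def by auto
    \<comment> \<open>Reflection reverses the order, so noncrossing relates the images of
      \<open>l\<close> and \<open>k\<close>; transitivity along \<open>i, k, l, j\<close> then gives
      the claim.\<close>
    have "(n + 1 - l, n + 1 - k) \<in> dual_rel n r"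
      by (rule nc_equiv_nc[OF D, of _ _ "n + 1 - j" "n + 1 - i"])
        (use ijkl \<open>l \<le> n\<close> ik jl in \<open>auto simp: flip_def intro: nc_equiv_sym[OF D]\<close>)
    then show "(i, j) \<in> flip n r"
      using ik jl nc_equiv_sym[OF D] nc_equiv_trans[OF D] unfolding flip_def by blast
  next
    show "(x, x) \<in> flip n r" if "x \<in> {1..n}" for x
      using that nc_equiv_refl[OF D] reflect_in_range unfolding flip_def by blast
  qed (use nc_equiv_sym[OF D] nc_equiv_trans[OF D] in \<open>unfold flip_def; blast\<close>)+
qed

text \<open>The pairs of \<open>flip n r\<close> are the reflected dual pairs of \<open>r\<close>.
  Forward, \<open>nc_equiv_bidual\<close> recovers \<open>r\<close> from them; backward is the
  definition of the dual read through the reflection.\<close>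

lemma dual_rel_flip:
  assumes r: "r \<in> nc_equiv n" and x: "x \<in> {1..n}" and y: "y \<in> {1..n}"
  shows "(x, y) \<in> dual_rel n (flip n r) \<longleftrightarrow> (n + 1 - x, n + 1 - y) \<in> r"
proof
  note x' = reflect_in_range[OF x] and y' = reflect_in_range[OF y]
  have less: "u < n + 1 - z \<longleftrightarrow> z < n + 1 - u" if "u \<in> {1..n}" "z \<in> {1..n}" for u z
    using that by auto
  show "(n + 1 - x, n + 1 - y) \<in> r" if dual: "(x, y) \<in> dual_rel n (flip n r)"
    unfolding nc_equiv_bidual[OF r x' y']
  proof clarify
    fix u v assume uv: "(u, v) \<in> dual_rel n r"
    note bounds = dual_relD(1,2)[OF uv]
    then have "(n + 1 - u, n + 1 - v) \<in> flip n r"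
      using uv unfolding flip_def by auto
    from dual_relD(3)[OF dual this]
    show "(u < n + 1 - x \<longleftrightarrow> v < n + 1 - x) \<longleftrightarrow> (u < n + 1 - y \<longleftrightarrow> v < n + 1 - y)"
      using less bounds x y by blast
  qed
  show "(x, y) \<in> dual_rel n (flip n r)" if xy: "(n + 1 - x, n + 1 - y) \<in> r"
  proof (rule dual_relI[OF x y])
    fix u v assume uv: "(u, v) \<in> flip n r"
    then have bounds: "u \<in> {1..n}" "v \<in> {1..n}"
      and dual: "(n + 1 - u, n + 1 - v) \<in> dual_rel n r"
      unfolding flip_def by auto
    have less: "n + 1 - u < n + 1 - z \<longleftrightarrow> z < u" if "u \<in> {1..n}" for u z
      using that by auto
    show "(x < u \<longleftrightarrow> x < v) \<longleftrightarrow> (y < u \<longleftrightarrow> y < v)"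
      using dual_relD(3)[OF dual xy] less bounds by blast
  qed
qed

lemma flip_flip:
  assumes "r \<in> nc_equiv n"
  shows "flip n (flip n r) = r"
proof -
  have "(x, y) \<in> flip n (flip n r) \<longleftrightarrow> (x, y) \<in> r" for x y
  proof (cases "x \<in> {1..n} \<and> y \<in> {1..n}")
    case True
    then show ?thesis
      using dual_rel_flip[OF assms reflect_in_range reflect_in_range, of x y]
      unfolding flip_def[of n "flip n r"] by (auto simp: reflect_reflect)
  next
    case False
    then show ?thesis
      using nc_equiv_field[OF assms] unfolding flip_def[of n "flip n r"] by blast
  qed
  then show ?thesis
    by auto
qed

lemma card_class_flip:
  assumes "x \<in> {1..n}"
  shows "card (flip n r `` {x}) = card (dual_rel n r `` {n + 1 - x})"
proof (rule bij_betw_same_card)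
  show "bij_betw (\<lambda>y. n + 1 - y) (flip n r `` {x}) (dual_rel n r `` {n + 1 - x})"
    by (rule bij_betw_byWitness[where f' = "\<lambda>y. n + 1 - y"])
      (use assms in \<open>auto simp: flip_def dual_rel_def\<close>)
qed

lemma card_class_dual_rel_flip:
  assumes "r \<in> nc_equiv n" "x \<in> {1..n}"
  shows "card (dual_rel n (flip n r) `` {x}) = card (r `` {n + 1 - x})"
  using card_class_flip[OF reflect_in_range[OF assms(2)], of "flip n r"] assms
  by (simp only: flip_flip reflect_reflect)

section \<open>The Kreweras dual as a relation\<close>

lemma quotient_block_rel:
  assumes "equiv A r" "B \<in> A // r" "x \<in> B" "y \<in> B"
  shows "(x, y) \<in> r"
  using quotient_eq_iff[OF assms(1) assms(2) assms(2) assms(3) assms(4)] by simp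

lemma noncrossingD:
  assumes "noncrossing P" "B \<in> P" "C \<in> P" "i < j" "j < k" "k < l"
    and "i \<in> B" "k \<in> B" "j \<in> C" "l \<in> C"
  shows "B = C"
proof (rule ccontr)
  assume "B \<noteq> C"
  moreover have "\<exists>i j k l. i < j \<and> j < k \<and> k < l \<and> i \<in> B \<and> k \<in> B \<and> j \<in> C \<and> l \<in> C"
    using assms(4-) by (intro exI conjI)
  ultimately have "\<exists>B\<in>P. \<exists>C\<in>P. B \<noteq> C \<and>
      (\<exists>i j k l. i < j \<and> j < k \<and> k < l \<and> i \<in> B \<and> k \<in> B \<and> j \<in> C \<and> l \<in> C)"
    by (intro bexI[OF _ assms(2)] bexI[OF _ assms(3)] conjI)
  with assms(1) show False
    unfolding noncrossing_def by (rule notE)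
qed

lemma noncrossingI:
  assumes eq: "\<And>B C i j k l. B \<in> P \<Longrightarrow> C \<in> P \<Longrightarrow> i < j \<Longrightarrow> j < k \<Longrightarrow> k < l \<Longrightarrow>
    i \<in> B \<Longrightarrow> k \<in> B \<Longrightarrow> j \<in> C \<Longrightarrow> l \<in> C \<Longrightarrow> B = C"
  shows "noncrossing P"
  unfolding noncrossing_def
proof (rule notI, elim bexE conjE exE)
  fix B C i j k l
  assume "B \<noteq> C" and H: "B \<in> P" "C \<in> P" "i < j" "j < k" "k < l" "i \<in> B" "k \<in> B" "j \<in> C" "l \<in> C"
  then show False
    using eq[OF H] by simp
qed

lemma noncrossing_quotient_iff:
  assumes r: "equiv {1..n} r"
  shows "noncrossing ({1..n} // r) \<longleftrightarrow> noncrossing_rel r"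
proof
  assume nc: "noncrossing ({1..n} // r)"
  show "noncrossing_rel r"
    unfolding noncrossing_rel_def
  proof clarify
    fix i j k l assume H: "i < j" "j < k" "k < l" and ik: "(i, k) \<in> r" and jl: "(j, l) \<in> r"
    have field: "i \<in> {1..n}" "j \<in> {1..n}"
      using ik jl equiv_type[OF r] by auto
    have "r `` {i} \<in> {1..n} // r" "r `` {j} \<in> {1..n} // r"
      using field by (blast intro: quotientI)+
    moreover have "i \<in> r `` {i}" "k \<in> r `` {i}" "j \<in> r `` {j}" "l \<in> r `` {j}"
      using ik jl equiv_class_self[OF r] field by auto
    ultimately have "r `` {i} = r `` {j}"
      by (rule noncrossingD[OF nc _ _ H])
    then show "(i, j) \<in> r"
      using eq_equiv_class_iff[OF r field] by simp
  qed
next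
  assume nc: "noncrossing_rel r"
  show "noncrossing ({1..n} // r)"
  proof (rule noncrossingI)
    fix B C i j k l assume BC: "B \<in> {1..n} // r" "C \<in> {1..n} // r" and H: "i < j" "j < k" "k < l"
      and in_B: "i \<in> B" "k \<in> B" and in_C: "j \<in> C" "l \<in> C"
    have "(i, k) \<in> r" "(j, l) \<in> r"
      using quotient_block_rel[OF r] BC in_B in_C by blast+
    then have "(i, j) \<in> r"
      using nc H unfolding noncrossing_rel_def by blast
    then show "B = C"
      using quotient_eqI[OF r BC in_B(1) in_C(1)] by simp
  qed
qed

lemma bij_betw_nc_equiv:
  "bij_betw (\<lambda>r. {1..n} // r) (nc_equiv n) (noncrossing_partitions n)"
proof (rule bij_betw_imageI)
  show "inj_on (\<lambda>r. {1..n} // r) (nc_equiv n)"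
  proof (rule inj_onI)
    have *: "(x, y) \<in> s"
      if "r \<in> nc_equiv n" "s \<in> nc_equiv n" "{1..n} // r = {1..n} // s" "(x, y) \<in> r" for r s x y
    proof -
      have r: "equiv {1..n} r" and s: "equiv {1..n} s"
        using that(1,2) unfolding nc_equiv_def by auto
      have "x \<in> {1..n}"
        using equiv_type[OF r] that(4) by auto
      then have "r `` {x} \<in> {1..n} // s" "x \<in> r `` {x}" "y \<in> r `` {x}"
        using that(4) quotientI[of x "{1..n}" r] equiv_class_self[OF r] unfolding that(3) by blast+
      then show ?thesis
        using quotient_block_rel[OF s] by blast
    qed
    show "r = s"
      if "r \<in> nc_equiv n" "s \<in> nc_equiv n" "{1..n} // r = {1..n} // s" for r s
      using *[OF that] *[OF that(2,1) that(3)[symmetric]] by auto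
  qed
  show "(\<lambda>r. {1..n} // r) ` nc_equiv n = noncrossing_partitions n"
  proof (intro equalityI subsetI)
    fix P assume "P \<in> (\<lambda>r. {1..n} // r) ` nc_equiv n"
    then show "P \<in> noncrossing_partitions n"
      unfolding noncrossing_partitions_def nc_equiv_def
      using partition_on_quotient noncrossing_quotient_iff by blast
  next
    fix P assume P: "P \<in> noncrossing_partitions n"
    then obtain r where "equiv {1..n} r" "P = {1..n} // r"
      unfolding noncrossing_partitions_def using partition_on_alt by blast
    then show "P \<in> (\<lambda>r. {1..n} // r) ` nc_equiv n"
      using P noncrossing_quotient_iff unfolding noncrossing_partitions_def nc_equiv_def by blast
  qed
qed

text \<open>Two blocks of the same kind do not cross because \<open>r\<close> and its dual are both
  noncrossing; a block of \<open>r\<close> crossing a dual block would contain a pair that separates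
  two dual cuts.\<close>

lemma noncrossing_circle_blocks_dual:
  assumes r: "r \<in> nc_equiv n"
  shows "noncrossing (circle_blocks ({1..n} // r) ({1..n} // dual_rel n r))"
  unfolding circle_blocks_def
proof (rule noncrossingI)
  let ?o = "\<lambda>i::nat. 2 * i - 1" and ?e = "\<lambda>i::nat. 2 * i"
  have eq_r: "equiv {1..n} r" and eq_d: "equiv {1..n} (dual_rel n r)"
    using r dual_rel_nc_equiv unfolding nc_equiv_def by auto
  have nc_r: "noncrossing ({1..n} // r)" and nc_d: "noncrossing ({1..n} // dual_rel n r)"
    using r dual_rel_nc_equiv noncrossing_quotient_iff[OF eq_r] noncrossing_quotient_iff[OF eq_d]
    unfolding nc_equiv_def by auto
  fix B C i j k l
  assume B: "B \<in> (`) ?o ` ({1..n} // r) \<union> (`) ?e ` ({1..n} // dual_rel n r)"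
    and C: "C \<in> (`) ?o ` ({1..n} // r) \<union> (`) ?e ` ({1..n} // dual_rel n r)"
    and H: "i < j" "j < k" "k < l" and in_B: "i \<in> B" "k \<in> B" and in_C: "j \<in> C" "l \<in> C"
  \<comment> \<open>Since \<open>2 * u < 2 * x - 1\<close> means \<open>u < x\<close>, either
    interleaving says that exactly one of the cuts \<open>u\<close> and \<open>v\<close> separates
    \<open>x\<close> from \<open>y\<close>.\<close>
  have odd_even: False
    if "D \<in> {1..n} // r" "E \<in> {1..n} // dual_rel n r"
      and xy: "x \<in> D" "y \<in> D" and uv: "u \<in> E" "v \<in> E"
      and H: "?o x < ?e u \<and> ?e u < ?o y \<and> ?o y < ?e v \<or>
        ?e u < ?o x \<and> ?o x < ?e v \<and> ?e v < ?o y" for D E x y u v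
  proof -
    have "(x, y) \<in> r" "(u, v) \<in> dual_rel n r"
      using quotient_block_rel[OF eq_r] quotient_block_rel[OF eq_d] that by blast+
    then have "(u < x \<longleftrightarrow> u < y) \<longleftrightarrow> (v < x \<longleftrightarrow> v < y)"
      using dual_relD(3) by blast
    then show False
      using H by linarith
  qed
  consider
    (oo) B' C' where "B' \<in> {1..n} // r" "C' \<in> {1..n} // r" "B = ?o ` B'" "C = ?o ` C'" |
    (oe) B' C' where "B' \<in> {1..n} // r" "C' \<in> {1..n} // dual_rel n r" "B = ?o ` B'" "C = ?e ` C'" |
    (eo) B' C' where "B' \<in> {1..n} // dual_rel n r" "C' \<in> {1..n} // r" "B = ?e ` B'" "C = ?o ` C'" |
    (ee) B' C' where "B' \<in> {1..n} // dual_rel n r" "C' \<in> {1..n} // dual_rel n r"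
      "B = ?e ` B'" "C = ?e ` C'"
    using B C by blast
  then show "B = C"
  proof cases
    case oo
    obtain i' j' k' l' where "i' \<in> B'" "k' \<in> B'" "j' \<in> C'" "l' \<in> C'"
      "i = ?o i'" "k = ?o k'" "j = ?o j'" "l = ?o l'"
      using in_B in_C oo by blast
    moreover from this have "i' < j'" "j' < k'" "k' < l'"
      using H by linarith+
    ultimately have "B' = C'"
      using noncrossingD[OF nc_r oo(1,2)] by blast
    then show ?thesis
      using oo by simp
  next
    case oe
    obtain i' j' k' l' where "i' \<in> B'" "k' \<in> B'" "j' \<in> C'" "l' \<in> C'"
      "i = ?o i'" "k = ?o k'" "j = ?e j'" "l = ?e l'"
      using in_B in_C oe by blast
    then show ?thesis
      using odd_even[OF oe(1,2), of i' k' j' l'] H by blast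
  next
    case eo
    obtain i' j' k' l' where "i' \<in> B'" "k' \<in> B'" "j' \<in> C'" "l' \<in> C'"
      "i = ?e i'" "k = ?e k'" "j = ?o j'" "l = ?o l'"
      using in_B in_C eo by blast
    then show ?thesis
      using odd_even[OF eo(2,1), of j' l' i' k'] H by blast
  next
    case ee
    obtain i' j' k' l' where "i' \<in> B'" "k' \<in> B'" "j' \<in> C'" "l' \<in> C'"
      "i = ?e i'" "k = ?e k'" "j = ?e j'" "l = ?e l'"
      using in_B in_C ee by blast
    moreover from this have "i' < j'" "j' < k'" "k' < l'"
      using H by linarith+
    ultimately have "B' = C'"
      using noncrossingD[OF nc_d ee(1,2)] by blast
    then show ?thesis
      using ee by simp
  qed
qed

text \<open>This gives the maximality of the dual: two related cuts, exactly one of which separates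
  a pair of \<open>r\<close>, would make the two blocks cross on the circle.\<close>

lemma noncrossing_circle_blocks_imp_subset_dual:
  assumes r: "equiv {1..n} r" and s: "equiv {1..n} s"
    and nc: "noncrossing (circle_blocks ({1..n} // r) ({1..n} // s))"
  shows "s \<subseteq> dual_rel n r"
proof -
  let ?o = "\<lambda>i::nat. 2 * i - 1" and ?e = "\<lambda>i::nat. 2 * i"
  \<comment> \<open>One orientation of the disagreement, with \<open>x\<close> between the two cuts
    and \<open>y\<close> not; swapping \<open>i, j\<close> and \<open>x, y\<close> yields the
    others.\<close>
  have *: "\<not> (i < x \<and> x \<le> j \<and> (y \<le> i \<or> j < y))"
    if ij: "(i, j) \<in> s" and xy: "(x, y) \<in> r" for i j x y
  proof
    assume less: "i < x \<and> x \<le> j \<and> (y \<le> i \<or> j < y)"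
    let ?B = "?e ` (s `` {i})" and ?C = "?o ` (r `` {x})"
    have field: "i \<in> {1..n}" "x \<in> {1..n}" "y \<in> {1..n}"
      using ij xy equiv_type[OF r] equiv_type[OF s] by auto
    have in_B: "2 * i \<in> ?B" "2 * j \<in> ?B" and in_C: "2 * x - 1 \<in> ?C" "2 * y - 1 \<in> ?C"
      using ij xy equiv_class_self[OF r] equiv_class_self[OF s] field by auto
    have B: "?B \<in> circle_blocks ({1..n} // r) ({1..n} // s)"
      unfolding circle_blocks_def by (intro UnI2 imageI quotientI field)
    have C: "?C \<in> circle_blocks ({1..n} // r) ({1..n} // s)"
      unfolding circle_blocks_def by (intro UnI1 imageI quotientI field)
    \<comment> \<open>Parity makes the two blocks different, as \<open>noncrossing\<close> only
      forbids crossings of different blocks. Here \<open>1 \<le> x\<close> prevents truncated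
      subtraction from giving the even number 0.\<close>
    have "odd (2 * x - 1)"
      using field by simp
    then have "2 * x - 1 \<notin> ?B"
      by (metis dvd_triv_left imageE)
    then have "?B \<noteq> ?C"
      using in_C by blast
    then have nc': "\<not> (a < b \<and> b < c \<and> c < d \<and> a \<in> ?B \<and> c \<in> ?B \<and> b \<in> ?C \<and> d \<in> ?C)"
      "\<not> (a < b \<and> b < c \<and> c < d \<and> a \<in> ?C \<and> c \<in> ?C \<and> b \<in> ?B \<and> d \<in> ?B)" for a b c d
      using noncrossingD[OF nc B C] noncrossingD[OF nc C B] by metis+
    have "2 * i < 2 * x - 1" "2 * x - 1 < 2 * j" "2 * y - 1 < 2 * i \<or> 2 * j < 2 * y - 1"
      using less field by auto
    then show False
      using nc'(1)[of "2 * i" "2 * x - 1" "2 * j" "2 * y - 1"]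
        nc'(2)[of "2 * y - 1" "2 * i" "2 * x - 1" "2 * j"] in_B in_C by blast
  qed
  show ?thesis
  proof clarify
    fix i j assume ij: "(i, j) \<in> s"
    show "(i, j) \<in> dual_rel n r"
    proof (rule dual_relI)
      fix x y assume xy: "(x, y) \<in> r"
      have "(j, i) \<in> s" "(y, x) \<in> r"
        using ij xy r s unfolding equiv_def sym_def by blast+
      then show "(i < x \<longleftrightarrow> i < y) \<longleftrightarrow> (j < x \<longleftrightarrow> j < y)"
        using *[of i j x y] *[of i j y x] *[of j i x y] *[of j i y x] ij xy by linarith
    qed (use ij equiv_type[OF s] in auto)
  qed
qed

text \<open>The definite description is well defined because two greatest elements refine each other
  and hence coincide.\<close>

lemma kreweras_dual_quotient:
  assumes r: "r \<in> nc_equiv n"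
  shows "kreweras_dual n ({1..n} // r) = {1..n} // dual_rel n r"
  unfolding kreweras_dual_def
proof (rule the_equality)
  have eq_r: "equiv {1..n} r" and eq_d: "equiv {1..n} (dual_rel n r)"
    using r dual_rel_nc_equiv unfolding nc_equiv_def by auto
  have part: "partition_on {1..n} ({1..n} // dual_rel n r)"
    using eq_d by (rule partition_on_quotient)
  have greatest: "refines {1..n} R ({1..n} // dual_rel n r)"
    if R: "partition_on {1..n} R" "noncrossing (circle_blocks ({1..n} // r) R)" for R
  proof -
    obtain s where s: "equiv {1..n} s" "R = {1..n} // s"
      using R(1) partition_on_alt by blast
    have "s \<subseteq> dual_rel n r"
      using s noncrossing_circle_blocks_imp_subset_dual[OF eq_r] R(2) by blast
    have "\<exists>Y\<in>{1..n} // dual_rel n r. X \<subseteq> Y" if X: "X \<in> R" for X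
    proof -
      obtain x where x: "x \<in> {1..n}" "X = s `` {x}"
        using X unfolding s(2) by (rule quotientE)
      have "dual_rel n r `` {x} \<in> {1..n} // dual_rel n r"
        using x(1) by (rule quotientI)
      moreover have "X \<subseteq> dual_rel n r `` {x}"
        unfolding x(2) using \<open>s \<subseteq> dual_rel n r\<close> by blast
      ultimately show ?thesis
        by blast
    qed
    then show ?thesis
      unfolding refines_def using R(1) part by blast
  qed
  show dual: "is_kreweras_dual n ({1..n} // r) ({1..n} // dual_rel n r)"
    unfolding is_kreweras_dual_def
    using part noncrossing_circle_blocks_dual[OF r] greatest by blast
  show "Q = {1..n} // dual_rel n r" if Q: "is_kreweras_dual n ({1..n} // r) Q" for Q
  proof (rule refines_asym)
    show "refines {1..n} Q ({1..n} // dual_rel n r)"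
      using Q greatest unfolding is_kreweras_dual_def by simp
    show "refines {1..n} ({1..n} // dual_rel n r) Q"
      using Q dual unfolding is_kreweras_dual_def by simp
  qed
qed

section \<open>Direct sums\<close>

definition direct_sum :: "nat \<Rightarrow> (nat \<times> nat) set \<Rightarrow> (nat \<times> nat) set \<Rightarrow> (nat \<times> nat) set" where
  "direct_sum m r s = r \<union> {(x, y). m < x \<and> m < y \<and> (x - m, y - m) \<in> s}"

definition left_part :: "nat \<Rightarrow> (nat \<times> nat) set \<Rightarrow> (nat \<times> nat) set" where
  "left_part m q = {(x, y) \<in> q. x \<le> m \<and> y \<le> m}"

definition right_part :: "nat \<Rightarrow> (nat \<times> nat) set \<Rightarrow> (nat \<times> nat) set" where
  "right_part m q = {(x, y). 0 < x \<and> 0 < y \<and> (x + m, y + m) \<in> q}"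

lemma left_part_nc_equiv:
  assumes "q \<in> nc_equiv n" "m \<le> n"
  shows "left_part m q \<in> nc_equiv m"
proof (rule nc_equivI)
  show "(x, y) \<in> left_part m q \<Longrightarrow> x \<in> {1..m} \<and> y \<in> {1..m}" for x y
    using nc_equiv_field[OF assms(1), of x y] unfolding left_part_def by auto
  show "x \<in> {1..m} \<Longrightarrow> (x, x) \<in> left_part m q" for x
    using nc_equiv_refl[OF assms(1), of x] assms(2) unfolding left_part_def by auto
  show "(x, y) \<in> left_part m q \<Longrightarrow> (y, x) \<in> left_part m q" for x y
    using nc_equiv_sym[OF assms(1), of x y] unfolding left_part_def by auto
  show "(x, y) \<in> left_part m q \<Longrightarrow> (y, z) \<in> left_part m q \<Longrightarrow> (x, z) \<in> left_part m q" for x y z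
    using nc_equiv_trans[OF assms(1), of x y z] unfolding left_part_def by auto
  show "(i, j) \<in> left_part m q"
    if "i < j" "j < k" "k < l" "(i, k) \<in> left_part m q" "(j, l) \<in> left_part m q" for i j k l
    using nc_equiv_nc[OF assms(1) that(1-3)] that(4,5) unfolding left_part_def by auto
qed

lemma right_part_nc_equiv:
  assumes "q \<in> nc_equiv (m + k)"
  shows "right_part m q \<in> nc_equiv k"
proof (rule nc_equivI)
  show "(x, y) \<in> right_part m q \<Longrightarrow> x \<in> {1..k} \<and> y \<in> {1..k}" for x y
    using nc_equiv_field[OF assms(1), of "x + m" "y + m"] unfolding right_part_def by auto
  show "x \<in> {1..k} \<Longrightarrow> (x, x) \<in> right_part m q" for x
    using nc_equiv_refl[OF assms(1), of "x + m"] unfolding right_part_def by auto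
  show "(x, y) \<in> right_part m q \<Longrightarrow> (y, x) \<in> right_part m q" for x y
    using nc_equiv_sym[OF assms(1), of "x + m" "y + m"] unfolding right_part_def by auto
  show "(x, y) \<in> right_part m q \<Longrightarrow> (y, z) \<in> right_part m q \<Longrightarrow> (x, z) \<in> right_part m q" for x y z
    using nc_equiv_trans[OF assms(1), of "x + m" "y + m" "z + m"] unfolding right_part_def by auto
  show "(i, j) \<in> right_part m q"
    if "i < j" "j < k" "k < l" "(i, k) \<in> right_part m q" "(j, l) \<in> right_part m q" for i j k l
    using nc_equiv_nc[OF assms(1), of "i + m" "j + m" "k + m" "l + m"] that
    unfolding right_part_def by auto
qed

section \<open>Classes and dual classes of a direct sum\<close>

context
  fixes m k :: nat and r s :: "(nat \<times> nat) set"
  assumes r: "r \<in> nc_equiv m" and s: "s \<in> nc_equiv k"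
begin

lemma direct_sum_cases:
  assumes "(x, y) \<in> direct_sum m r s"
  obtains "x \<in> {1..m}" "y \<in> {1..m}" "(x, y) \<in> r"
    | "m < x" "x \<le> m + k" "m < y" "y \<le> m + k" "(x - m, y - m) \<in> s"
  using assms nc_equiv_field[OF r, of x y] nc_equiv_field[OF s, of "x - m" "y - m"]
  unfolding direct_sum_def by auto

lemma direct_sum_nc_equiv: "direct_sum m r s \<in> nc_equiv (m + k)"
proof (rule nc_equivI)
  show "x \<in> {1..m + k} \<and> y \<in> {1..m + k}" if "(x, y) \<in> direct_sum m r s" for x y
    using that by (rule direct_sum_cases) auto
  show "(x, x) \<in> direct_sum m r s" if "x \<in> {1..m + k}" for x
  proof (cases "x \<le> m")
    case True
    then show ?thesis
      using that nc_equiv_refl[OF r, of x] unfolding direct_sum_def by simp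
  next
    case False
    then have "x - m \<in> {1..k}"
      using that by auto
    then show ?thesis
      using False nc_equiv_refl[OF s] unfolding direct_sum_def by simp
  qed
  show "(y, x) \<in> direct_sum m r s" if "(x, y) \<in> direct_sum m r s" for x y
    using that nc_equiv_sym[OF r, of x y] nc_equiv_sym[OF s, of "x - m" "y - m"]
    unfolding direct_sum_def by auto
  show "(x, z) \<in> direct_sum m r s"
    if xy: "(x, y) \<in> direct_sum m r s" and yz: "(y, z) \<in> direct_sum m r s" for x y z
  proof (rule direct_sum_cases[OF xy]; rule direct_sum_cases[OF yz])
    show ?thesis if "(x, y) \<in> r" "(y, z) \<in> r"
      using nc_equiv_trans[OF r that] unfolding direct_sum_def by simp
    show ?thesis if "(x - m, y - m) \<in> s" "(y - m, z - m) \<in> s" "m < x" "m < z"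
      using nc_equiv_trans[OF s that(1,2)] that(3,4) unfolding direct_sum_def by simp
  qed auto
  show "(i, j) \<in> direct_sum m r s" if ijkl: "i < j" "j < k'" "k' < l"
    and ik: "(i, k') \<in> direct_sum m r s" and jl: "(j, l) \<in> direct_sum m r s" for i j k' l
  proof (rule direct_sum_cases[OF ik]; rule direct_sum_cases[OF jl])
    show ?thesis if "(i, k') \<in> r" "(j, l) \<in> r"
      using nc_equiv_nc[OF r ijkl that] unfolding direct_sum_def by simp
    show ?thesis if "(i - m, k' - m) \<in> s" "(j - m, l - m) \<in> s" "m < i" "m < j"
      using nc_equiv_nc[OF s _ _ _ that(1,2)] that(3,4) ijkl unfolding direct_sum_def by simp
  qed (use ijkl in auto)
qed

lemma left_part_direct_sum: "left_part m (direct_sum m r s) = r"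
  using nc_equiv_field[OF r] unfolding left_part_def direct_sum_def by auto

lemma right_part_direct_sum: "right_part m (direct_sum m r s) = s"
  using nc_equiv_field[OF r] nc_equiv_field[OF s] unfolding right_part_def direct_sum_def by fastforce

lemma direct_sum_class_left: "x \<le> m \<Longrightarrow> direct_sum m r s `` {x} = r `` {x}"
  unfolding direct_sum_def by auto

lemma direct_sum_class_right:
  assumes "0 < x"
  shows "direct_sum m r s `` {m + x} = (+) m ` (s `` {x})"
proof -
  have "(m + x, y) \<notin> r" for y
    using nc_equiv_field[OF r, of "m + x" y] assms by auto
  moreover have "y \<in> (+) m ` (s `` {x}) \<longleftrightarrow> m < y \<and> (x, y - m) \<in> s" for y
    using nc_equiv_field[OF s, of x] by (force simp: image_iff)
  ultimately show ?thesis
    using assms unfolding direct_sum_def by auto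
qed

lemma dual_rel_direct_sum_left:
  assumes "x \<in> {1..m}" "y \<in> {1..m}"
  shows "(x, y) \<in> dual_rel (m + k) (direct_sum m r s) \<longleftrightarrow> (x, y) \<in> dual_rel m r"
proof
  assume dual: "(x, y) \<in> dual_rel (m + k) (direct_sum m r s)"
  show "(x, y) \<in> dual_rel m r"
    by (rule dual_relI[OF assms dual_relD(3)[OF dual]]) (simp add: direct_sum_def)
next
  assume dual: "(x, y) \<in> dual_rel m r"
  show "(x, y) \<in> dual_rel (m + k) (direct_sum m r s)"
  proof (rule dual_relI)
    fix u v assume "(u, v) \<in> direct_sum m r s"
    then show "(x < u \<longleftrightarrow> x < v) \<longleftrightarrow> (y < u \<longleftrightarrow> y < v)"
      by (rule direct_sum_cases) (use dual_relD(3)[OF dual] assms in auto)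
  qed (use assms in auto)
qed

lemma dual_rel_direct_sum_right:
  assumes "x \<in> {1..k}" "y \<in> {1..k}"
  shows "(m + x, m + y) \<in> dual_rel (m + k) (direct_sum m r s) \<longleftrightarrow> (x, y) \<in> dual_rel k s"
proof
  assume dual: "(m + x, m + y) \<in> dual_rel (m + k) (direct_sum m r s)"
  show "(x, y) \<in> dual_rel k s"
  proof (rule dual_relI[OF assms])
    fix u v assume uv: "(u, v) \<in> s"
    then have "(m + u, m + v) \<in> direct_sum m r s"
      using nc_equiv_field[OF s uv] unfolding direct_sum_def by simp
    from dual_relD(3)[OF dual this]
    show "(x < u \<longleftrightarrow> x < v) \<longleftrightarrow> (y < u \<longleftrightarrow> y < v)"
      by simp
  qed
next
  assume dual: "(x, y) \<in> dual_rel k s"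
  show "(m + x, m + y) \<in> dual_rel (m + k) (direct_sum m r s)"
  proof (rule dual_relI)
    fix u v assume "(u, v) \<in> direct_sum m r s"
    then show "(m + x < u \<longleftrightarrow> m + x < v) \<longleftrightarrow> (m + y < u \<longleftrightarrow> m + y < v)"
    proof (rule direct_sum_cases)
      assume "(u - m, v - m) \<in> s"
      from dual_relD(3)[OF dual this] show ?thesis
        by (simp add: less_diff_conv add.commute)
    qed auto
  qed (use assms in auto)
qed

text \<open>Neither the cut at the junction nor the cut after the last point separates any pair.
  This is the only way in which the dual of a direct sum differs from the direct sum of the duals:
  the dual classes of the two last points merge.\<close>

lemma dual_rel_direct_sum_last:
  assumes "0 < m"
  shows "(m, m + k) \<in> dual_rel (m + k) (direct_sum m r s)"
proof (rule dual_relI)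
  fix u v assume "(u, v) \<in> direct_sum m r s"
  then show "(m < u \<longleftrightarrow> m < v) \<longleftrightarrow> (m + k < u \<longleftrightarrow> m + k < v)"
    by (rule direct_sum_cases) auto
qed (use assms in auto)

text \<open>No pair of \<open>r\<close> is separated by the cut \<open>m + y\<close>, so for
  \<open>r\<close> that cut acts like \<open>m\<close>; likewise no shifted pair of \<open>s\<close>
  is separated by \<open>x\<close>, so for \<open>s\<close> that cut acts like
  \<open>k\<close>.\<close>

lemma dual_rel_direct_sum_cross:
  assumes x: "x \<in> {1..m}" and y: "y \<in> {1..k}"
    and dual: "(x, m + y) \<in> dual_rel (m + k) (direct_sum m r s)"
  shows "(x, m) \<in> dual_rel m r" "(y, k) \<in> dual_rel k s"
proof -
  show "(x, m) \<in> dual_rel m r"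
  proof (rule dual_relI)
    fix u v assume uv: "(u, v) \<in> r"
    then have "(u, v) \<in> direct_sum m r s"
      unfolding direct_sum_def by simp
    from dual_relD(3)[OF dual this] nc_equiv_field[OF r uv]
    show "(x < u \<longleftrightarrow> x < v) \<longleftrightarrow> (m < u \<longleftrightarrow> m < v)"
      by auto
  qed (use x in auto)
  show "(y, k) \<in> dual_rel k s"
  proof (rule dual_relI)
    fix u v assume uv: "(u, v) \<in> s"
    note bounds = nc_equiv_field[OF s uv]
    then have "(m + u, m + v) \<in> direct_sum m r s"
      using uv unfolding direct_sum_def by simp
    from dual_relD(3)[OF dual this] bounds x
    show "(y < u \<longleftrightarrow> y < v) \<longleftrightarrow> (k < u \<longleftrightarrow> k < v)"
      by auto
  qed (use y in auto)
qed

end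

text \<open>The cut \<open>n\<close> separates no pair, so a cut \<open>m\<close> dual to it
  separates none either, and every pair of \<open>q\<close> stays on one side of
  \<open>m\<close>.\<close>

lemma direct_sum_parts:
  assumes q: "q \<in> nc_equiv n" and m: "(m, n) \<in> dual_rel n q"
  shows "direct_sum m (left_part m q) (right_part m q) = q"
proof -
  have sides: "x \<le> m \<longleftrightarrow> y \<le> m" if xy: "(x, y) \<in> q" for x y
    using dual_relD(3)[OF m xy] nc_equiv_field[OF q xy] by auto
  have "(x, y) \<in> direct_sum m (left_part m q) (right_part m q) \<longleftrightarrow> (x, y) \<in> q" for x y
    using sides[of x y] unfolding direct_sum_def left_part_def right_part_def
    by (cases "x \<le> m"; cases "y \<le> m") auto
  then show ?thesis
    by auto
qed

text \<open>The dual class of \<open>n\<close> is exempt from \<open>S\<close> because it is the one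
  that grows when pieces are placed side by side. The size \<open>t = 0\<close> occurs only for
  \<open>n = 0\<close>, where that class is empty.\<close>

definition open_rels :: "nat set \<Rightarrow> nat \<Rightarrow> nat \<Rightarrow> (nat \<times> nat) set set" where
  "open_rels S t n = {r \<in> nc_equiv n. (\<forall>x\<in>{1..n}. card (r `` {x}) \<in> S) \<and>
     card (dual_rel n r `` {n}) = t \<and>
     (\<forall>x\<in>{1..n}. (x, n) \<notin> dual_rel n r \<longrightarrow> card (dual_rel n r `` {x}) \<in> S)}"

lemma finite_open_rels: "finite (open_rels S t n)"
  using finite_nc_equiv unfolding open_rels_def by (rule finite_subset[rotated]) blast

lemma open_rels_nc_equiv: "r \<in> open_rels S t n \<Longrightarrow> r \<in> nc_equiv n"
  unfolding open_rels_def by simp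

lemma dual_class_open_rels_1:
  assumes r: "r \<in> open_rels S 1 n" and n: "0 < n"
  shows "dual_rel n r `` {n} = {n}"
proof -
  have "card (dual_rel n r `` {n}) = 1" "n \<in> dual_rel n r `` {n}"
    using r n nc_equiv_refl[OF dual_rel_nc_equiv, of n n r] unfolding open_rels_def by auto
  then show ?thesis
    by (metis card_1_singletonE singletonD)
qed

text \<open>By \<open>last\<close> the first summand is indecomposable, so its only contribution is
  the junction \<open>m\<close>. For \<open>k = 0\<close> the image is empty and only
  \<open>m\<close> remains.\<close>

lemma dual_class_direct_sum:
  assumes r: "r \<in> nc_equiv m" and s: "s \<in> nc_equiv k" and m: "0 < m"
    and last: "dual_rel m r `` {m} = {m}"
  shows "dual_rel (m + k) (direct_sum m r s) `` {m + k} = insert m ((+) m ` (dual_rel k s `` {k}))"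
    (is "?D `` {_} = _")
proof (intro equalityI subsetI)
  note D = dual_rel_nc_equiv[of "m + k" "direct_sum m r s"]
  note D_last = dual_rel_direct_sum_last[OF r s m]
  fix z assume "z \<in> ?D `` {m + k}"
  then have z: "(z, m + k) \<in> ?D" "z \<in> {1..m + k}"
    using nc_equiv_sym[OF D] dual_relD by blast+
  show "z \<in> insert m ((+) m ` (dual_rel k s `` {k}))"
  proof (cases "z \<le> m")
    case True
    then have "z \<in> {1..m}" "m \<in> {1..m}" "(z, m) \<in> ?D"
      using z m nc_equiv_trans[OF D z(1) nc_equiv_sym[OF D D_last]] by auto
    then have "(z, m) \<in> dual_rel m r"
      using dual_rel_direct_sum_left[OF r s] by blast
    then show ?thesis
      using last nc_equiv_sym[OF dual_rel_nc_equiv] by blast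
  next
    case False
    then have "z - m \<in> {1..k}" "k \<in> {1..k}" "(m + (z - m), m + k) \<in> ?D"
      using z by auto
    then have "(z - m, k) \<in> dual_rel k s"
      using dual_rel_direct_sum_right[OF r s] by blast
    then have "z - m \<in> dual_rel k s `` {k}"
      using nc_equiv_sym[OF dual_rel_nc_equiv] by blast
    moreover have "z = m + (z - m)"
      using False by simp
    ultimately show ?thesis
      by blast
  qed
next
  note D = dual_rel_nc_equiv[of "m + k" "direct_sum m r s"]
  note D_last = dual_rel_direct_sum_last[OF r s m]
  fix z assume "z \<in> insert m ((+) m ` (dual_rel k s `` {k}))"
  then consider "z = m" | y where "z = m + y" "(k, y) \<in> dual_rel k s"
    by blast
  then show "z \<in> ?D `` {m + k}"
  proof cases
    case 1
    then show ?thesis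
      using nc_equiv_sym[OF D D_last] by simp
  next
    case 2
    then have "(m + k, m + y) \<in> ?D"
      using dual_rel_direct_sum_right[OF r s] dual_relD(1,2) by blast
    then show ?thesis
      using 2 by simp
  qed
qed

lemma dual_class_direct_sum_left:
  assumes r: "r \<in> nc_equiv m" and s: "s \<in> nc_equiv k" and x: "x \<in> {1..m}"
    and "(x, m) \<notin> dual_rel m r"
  shows "dual_rel (m + k) (direct_sum m r s) `` {x} = dual_rel m r `` {x}"
    and "(x, m + k) \<notin> dual_rel (m + k) (direct_sum m r s)"
proof -
  let ?D = "dual_rel (m + k) (direct_sum m r s)"
  have right: "(x, m + y) \<notin> ?D" if "y \<in> {1..k}" for y
    using dual_rel_direct_sum_cross(1)[OF r s x that] assms(4) by blast
  have left: "(x, y) \<in> ?D \<longleftrightarrow> (x, y) \<in> dual_rel m r" if "y \<in> {1..m}" for y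
    using dual_rel_direct_sum_left[OF r s x that] .
  have m: "m \<in> {1..m}"
    using x by auto
  show "(x, m + k) \<notin> ?D"
    using right[of k] left[OF m] assms(4) by (cases "k = 0") auto
  have "(x, y) \<in> ?D \<longleftrightarrow> (x, y) \<in> dual_rel m r" for y
  proof (cases "y \<in> {1..m}")
    case False
    then have "(x, y) \<notin> dual_rel m r"
      using dual_relD(2) by blast
    moreover have "(x, y) \<notin> ?D"
    proof
      assume xy: "(x, y) \<in> ?D"
      then have "y - m \<in> {1..k}" "y = m + (y - m)"
        using False dual_relD(2)[OF xy] by auto
      then show False
        using xy right by metis
    qed
    ultimately show ?thesis
      by simp
  qed (rule left)
  then show "?D `` {x} = dual_rel m r `` {x}"
    by blast
qed

lemma dual_class_direct_sum_right:
  assumes r: "r \<in> nc_equiv m" and s: "s \<in> nc_equiv k" and y: "y \<in> {1..k}"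
    and "(y, k) \<notin> dual_rel k s"
  shows "dual_rel (m + k) (direct_sum m r s) `` {m + y} = (+) m ` (dual_rel k s `` {y})"
    and "(m + y, m + k) \<notin> dual_rel (m + k) (direct_sum m r s)"
proof -
  let ?D = "dual_rel (m + k) (direct_sum m r s)"
  note D = dual_rel_nc_equiv[of "m + k" "direct_sum m r s"]
  have k: "k \<in> {1..k}"
    using y by auto
  have right: "(m + y, m + z) \<in> ?D \<longleftrightarrow> (y, z) \<in> dual_rel k s" if "z \<in> {1..k}" for z
    using dual_rel_direct_sum_right[OF r s y that] .
  then show "(m + y, m + k) \<notin> ?D"
    using assms(4) k by blast
  have left: "(m + y, z) \<notin> ?D" if "z \<in> {1..m}" for z
    using dual_rel_direct_sum_cross(2)[OF r s that y] assms(4) nc_equiv_sym[OF D] by blast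
  show "?D `` {m + y} = (+) m ` (dual_rel k s `` {y})"
  proof (intro equalityI subsetI)
    fix z assume "z \<in> ?D `` {m + y}"
    then have z: "(m + y, z) \<in> ?D" "z \<in> {1..m + k}" "z \<notin> {1..m}"
      using left dual_relD(2) by blast+
    then have "z - m \<in> {1..k}" "z = m + (z - m)"
      by auto
    then show "z \<in> (+) m ` (dual_rel k s `` {y})"
      using z(1) right[of "z - m"] by (metis Image_singleton_iff imageI)
  next
    fix z assume "z \<in> (+) m ` (dual_rel k s `` {y})"
    then obtain w where "z = m + w" "(y, w) \<in> dual_rel k s"
      by blast
    then show "z \<in> ?D `` {m + y}"
      using right[of w] dual_relD(2) by blast
  qed
qed

text \<open>All classes are copied from one of the summands, except that the dual class of the last
  point gains exactly the junction \<open>m\<close>. The equivalence serves both directions of the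
  bijection below.\<close>

lemma direct_sum_mem_open_rels_iff:
  assumes r: "r \<in> nc_equiv m" and s: "s \<in> nc_equiv k" and m: "0 < m"
    and last: "dual_rel m r `` {m} = {m}"
  shows "direct_sum m r s \<in> open_rels S (Suc t) (m + k) \<longleftrightarrow>
    r \<in> open_rels S 1 m \<and> s \<in> open_rels S t k"
proof -
  let ?q = "direct_sum m r s"
  let ?D = "dual_rel (m + k) ?q"
  have split: "(\<forall>x\<in>{1..m + k}. P x) \<longleftrightarrow> (\<forall>x\<in>{1..m}. P x) \<and> (\<forall>y\<in>{1..k}. P (m + y))" for P
  proof -
    have "{1..m + k} = {1..m} \<union> (+) m ` {1..k}"
      by (auto simp: image_iff)
    then show ?thesis
      by (simp only: ball_Un ball_simps)
  qed
  have "(\<forall>x\<in>{1..m + k}. card (?q `` {x}) \<in> S) \<longleftrightarrow>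
    (\<forall>x\<in>{1..m}. card (r `` {x}) \<in> S) \<and> (\<forall>y\<in>{1..k}. card (s `` {y}) \<in> S)"
    unfolding split
    using direct_sum_class_left[OF r s] direct_sum_class_right[OF r s] by (simp add: card_image)
  moreover have "card (?D `` {m + k}) = Suc (card (dual_rel k s `` {k}))"
  proof -
    have "m \<notin> (+) m ` (dual_rel k s `` {k})"
      by (auto dest: dual_relD(2))
    then show ?thesis
      unfolding dual_class_direct_sum[OF r s m last]
      using finite_class[OF dual_rel_nc_equiv] by (simp add: card_image)
  qed
  moreover have "(\<forall>x\<in>{1..m + k}. (x, m + k) \<notin> ?D \<longrightarrow> card (?D `` {x}) \<in> S) \<longleftrightarrow>
    (\<forall>x\<in>{1..m}. (x, m) \<notin> dual_rel m r \<longrightarrow> card (dual_rel m r `` {x}) \<in> S) \<and>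
    (\<forall>y\<in>{1..k}. (y, k) \<notin> dual_rel k s \<longrightarrow> card (dual_rel k s `` {y}) \<in> S)"
    unfolding split
  proof (intro conj_cong ball_cong refl)
    fix x assume x: "x \<in> {1..m}"
    show "((x, m + k) \<notin> ?D \<longrightarrow> card (?D `` {x}) \<in> S) \<longleftrightarrow>
      ((x, m) \<notin> dual_rel m r \<longrightarrow> card (dual_rel m r `` {x}) \<in> S)"
    proof (cases "(x, m) \<in> dual_rel m r")
      case True
      \<comment> \<open>The junction is exempt on both sides: as the last point of the first
        summand, and as a member of the dual class of \<open>m + k\<close>.\<close>
      then have "x = m"
        using last nc_equiv_sym[OF dual_rel_nc_equiv] by blast
      then show ?thesis
        using dual_rel_direct_sum_last[OF r s m] True by simp
    next
      case False
      then show ?thesis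
        using dual_class_direct_sum_left[OF r s x] by simp
    qed
  next
    fix y assume y: "y \<in> {1..k}"
    show "((m + y, m + k) \<notin> ?D \<longrightarrow> card (?D `` {m + y}) \<in> S) \<longleftrightarrow>
      ((y, k) \<notin> dual_rel k s \<longrightarrow> card (dual_rel k s `` {y}) \<in> S)"
    proof (cases "(y, k) \<in> dual_rel k s")
      case True
      then have "(m + y, m + k) \<in> ?D"
        using dual_rel_direct_sum_right[OF r s] dual_relD(1,2) by blast
      then show ?thesis
        using True by simp
    next
      case False
      then show ?thesis
        using dual_class_direct_sum_right[OF r s y] by (simp add: card_image)
    qed
  qed
  ultimately show ?thesis
    unfolding open_rels_def using r s direct_sum_nc_equiv[OF r s] last by auto
qed

text \<open>Cuts dual to \<open>n\<close> are those separating no pair, so the least one ends the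
  first indecomposable piece.\<close>

definition split_point :: "nat \<Rightarrow> (nat \<times> nat) set \<Rightarrow> nat" where
  "split_point n q = (LEAST z. (z, n) \<in> dual_rel n q)"

lemma split_point_direct_sum:
  assumes r: "r \<in> nc_equiv m" and s: "s \<in> nc_equiv k" and m: "0 < m"
    and last: "dual_rel m r `` {m} = {m}"
  shows "split_point (m + k) (direct_sum m r s) = m"
  unfolding split_point_def
proof (rule Least_equality)
  show "(m, m + k) \<in> dual_rel (m + k) (direct_sum m r s)"
    using dual_rel_direct_sum_last[OF r s m] .
  show "m \<le> z" if "(z, m + k) \<in> dual_rel (m + k) (direct_sum m r s)" for z
  proof -
    have "z \<in> insert m ((+) m ` (dual_rel k s `` {k}))"
      unfolding dual_class_direct_sum[OF assms, symmetric]
      using nc_equiv_sym[OF dual_rel_nc_equiv that] by simp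
    then show ?thesis
      by auto
  qed
qed

text \<open>Peeling off the first indecomposable piece. Its length \<open>m\<close> is recovered as
  the split point, which makes the decomposition unique.\<close>

lemma bij_betw_direct_sum:
  "bij_betw (\<lambda>(m, r, s). direct_sum m r s)
     (SIGMA m:{1..n}. open_rels S 1 m \<times> open_rels S t (n - m)) (open_rels S (Suc t) n)"
proof (rule bij_betw_byWitness[where f' = "\<lambda>q. let m = split_point n q in
    (m, left_part m q, right_part m q)"])
  have parts: "split_point n (direct_sum m r s) = m \<and> left_part m (direct_sum m r s) = r \<and>
      right_part m (direct_sum m r s) = s \<and> direct_sum m r s \<in> open_rels S (Suc t) n"
    if m: "m \<in> {1..n}" and r: "r \<in> open_rels S 1 m" and s: "s \<in> open_rels S t (n - m)" for m r s
  proof -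
    note r' = open_rels_nc_equiv[OF r] and s' = open_rels_nc_equiv[OF s]
    have n: "m + (n - m) = n" "0 < m"
      using m by auto
    note last = dual_class_open_rels_1[OF r n(2)]
    show ?thesis
      using split_point_direct_sum[OF r' s' n(2) last] left_part_direct_sum[OF r' s']
        right_part_direct_sum[OF r' s'] direct_sum_mem_open_rels_iff[OF r' s' n(2) last] r s
      unfolding n(1) by blast
  qed
  show "\<forall>a\<in>SIGMA m:{1..n}. open_rels S 1 m \<times> open_rels S t (n - m).
     (let m = split_point n (case a of (m, r, s) \<Rightarrow> direct_sum m r s)
      in (m, left_part m (case a of (m, r, s) \<Rightarrow> direct_sum m r s),
        right_part m (case a of (m, r, s) \<Rightarrow> direct_sum m r s))) = a"
    using parts by (auto simp: Let_def)
  show "(\<lambda>(m, r, s). direct_sum m r s) `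
      (SIGMA m:{1..n}. open_rels S 1 m \<times> open_rels S t (n - m)) \<subseteq> open_rels S (Suc t) n"
    using parts by auto
  have split: "split_point n q \<in> {1..n} \<and>
      left_part (split_point n q) q \<in> open_rels S 1 (split_point n q) \<and>
      right_part (split_point n q) q \<in> open_rels S t (n - split_point n q) \<and>
      direct_sum (split_point n q) (left_part (split_point n q) q) (right_part (split_point n q) q) = q"
    if q: "q \<in> open_rels S (Suc t) n" for q
  proof -
    note q' = open_rels_nc_equiv[OF q] and sym = nc_equiv_sym[OF dual_rel_nc_equiv]
    define m where "m = split_point n q"
    have "card (dual_rel n q `` {n}) = Suc t"
      using q unfolding open_rels_def by simp
    \<comment> \<open>The size \<open>Suc t\<close> is positive, so a split point exists.\<close>
    then have "dual_rel n q `` {n} \<noteq> {}"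
      by auto
    then have "\<exists>z. (z, n) \<in> dual_rel n q"
      using sym by blast
    then have mn: "(m, n) \<in> dual_rel n q"
      unfolding m_def split_point_def by (rule LeastI_ex)
    have m_le: "m \<le> z" if "(z, n) \<in> dual_rel n q" for z
      unfolding m_def split_point_def using that by (rule Least_le)
    have m: "m \<in> {1..n}" "0 < m" "m \<le> n" "m + (n - m) = n"
      using dual_relD(1)[OF mn] by auto
    have r: "left_part m q \<in> nc_equiv m"
      using left_part_nc_equiv[OF q' m(3)] .
    have s: "right_part m q \<in> nc_equiv (n - m)"
      using right_part_nc_equiv[of q m "n - m"] q' m(4) by simp
    have sum: "direct_sum m (left_part m q) (right_part m q) = q"
      using direct_sum_parts[OF q' mn] .
    \<comment> \<open>The left part is indecomposable by minimality: a cut dual to \<open>m\<close>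
      in it would also be dual to \<open>n\<close> in \<open>q\<close>.\<close>
    have last: "dual_rel m (left_part m q) `` {m} = {m}"
    proof (intro equalityI subsetI)
      fix z assume "z \<in> dual_rel m (left_part m q) `` {m}"
      then have z: "(z, m) \<in> dual_rel m (left_part m q)"
        using sym by blast
      note bounds = dual_relD(1,2)[OF z]
      have "(z, m) \<in> dual_rel n q"
        using dual_rel_direct_sum_left[OF r s bounds] z unfolding sum m(4) by blast
      then have "m \<le> z"
        using m_le nc_equiv_trans[OF dual_rel_nc_equiv _ mn] by blast
      then show "z \<in> {m}"
        using bounds by simp
    next
      fix z assume "z \<in> {m}"
      then show "z \<in> dual_rel m (left_part m q) `` {m}"
        using m nc_equiv_refl[OF dual_rel_nc_equiv, of m m] by simp
    qed
    show ?thesis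
      using direct_sum_mem_open_rels_iff[OF r s m(2) last, of S t] q m(1)
      unfolding sum m(4) m_def[symmetric] by blast
  qed
  show "\<forall>q\<in>open_rels S (Suc t) n. (case let m = split_point n q in
      (m, left_part m q, right_part m q) of (m, r, s) \<Rightarrow> direct_sum m r s) = q"
    using split by (auto simp: Let_def)
  show "(\<lambda>q. let m = split_point n q in (m, left_part m q, right_part m q)) `
      open_rels S (Suc t) n \<subseteq> (SIGMA m:{1..n}. open_rels S 1 m \<times> open_rels S t (n - m))"
    using split by (auto simp: Let_def)
qed

lemma card_open_rels_Suc:
  "card (open_rels S (Suc t) n) =
     (\<Sum>m=1..n. card (open_rels S 1 m) * card (open_rels S t (n - m)))"
proof -
  have "card (open_rels S (Suc t) n) =
      card (SIGMA m:{1..n}. open_rels S 1 m \<times> open_rels S t (n - m))"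
    using bij_betw_same_card[OF bij_betw_direct_sum] by simp
  then show ?thesis
    using finite_open_rels by (simp add: card_cartesian_product)
qed

section \<open>Removing the last point of an indecomposable relation\<close>

text \<open>The mirror image of \<open>open_rels\<close> under \<open>flip\<close>: the roles of the
  relation and its dual are exchanged, and the reflection carries \<open>n'\<close> to the point
  1.\<close>

definition rooted_rels :: "nat set \<Rightarrow> nat \<Rightarrow> nat \<Rightarrow> (nat \<times> nat) set set" where
  "rooted_rels S t n = {r \<in> nc_equiv n. (\<forall>x\<in>{1..n}. card (dual_rel n r `` {x}) \<in> S) \<and>
     card (r `` {1}) = t \<and> (\<forall>x\<in>{1..n}. (x, 1) \<notin> r \<longrightarrow> card (r `` {x}) \<in> S)}"

lemma rooted_rels_nc_equiv: "r \<in> rooted_rels S t n \<Longrightarrow> r \<in> nc_equiv n"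
  unfolding rooted_rels_def by simp

lemma ball_reflect: "(\<forall>x\<in>{1..n}. Q (n + 1 - x)) \<longleftrightarrow> (\<forall>x\<in>{1..n::nat}. Q x)"
  using reflect_in_range reflect_reflect by metis

lemma flip_mem_rooted_rels_iff:
  assumes r: "r \<in> nc_equiv n" and n: "0 < n"
  shows "flip n r \<in> rooted_rels S t n \<longleftrightarrow> r \<in> open_rels S t n"
proof -
  have 1: "1 \<in> {1..n}"
    using n by simp
  have "(\<forall>x\<in>{1..n}. card (dual_rel n (flip n r) `` {x}) \<in> S) \<longleftrightarrow>
      (\<forall>x\<in>{1..n}. card (r `` {x}) \<in> S)"
    using ball_reflect[of n "\<lambda>x. card (r `` {x}) \<in> S"] card_class_dual_rel_flip[OF r] by simp
  moreover have "card (flip n r `` {1}) = card (dual_rel n r `` {n})"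
    using card_class_flip[OF 1] by simp
  moreover have "(x, 1) \<in> flip n r \<longleftrightarrow> (n + 1 - x, n) \<in> dual_rel n r" if "x \<in> {1..n}" for x
    using that 1 unfolding flip_def by simp
  then have "(\<forall>x\<in>{1..n}. (x, 1) \<notin> flip n r \<longrightarrow> card (flip n r `` {x}) \<in> S) \<longleftrightarrow>
      (\<forall>x\<in>{1..n}. (x, n) \<notin> dual_rel n r \<longrightarrow> card (dual_rel n r `` {x}) \<in> S)"
    using ball_reflect[of n "\<lambda>x. (x, n) \<notin> dual_rel n r \<longrightarrow> card (dual_rel n r `` {x}) \<in> S"]
      card_class_flip by simp
  ultimately show ?thesis
    using r flip_nc_equiv
    by (simp only: rooted_rels_def open_rels_def mem_Collect_eq simp_thms)
qed

lemma card_rooted_rels: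
  assumes "0 < n"
  shows "card (rooted_rels S t n) = card (open_rels S t n)"
proof -
  have "bij_betw (flip n) (open_rels S t n) (rooted_rels S t n)"
  proof (rule bij_betw_byWitness[where f' = "flip n"])
    show "\<forall>r\<in>open_rels S t n. flip n (flip n r) = r"
      using open_rels_nc_equiv flip_flip by blast
    show "\<forall>r\<in>rooted_rels S t n. flip n (flip n r) = r"
      using rooted_rels_nc_equiv flip_flip by blast
    show "flip n ` open_rels S t n \<subseteq> rooted_rels S t n"
      using open_rels_nc_equiv flip_mem_rooted_rels_iff assms by blast
    show "flip n ` rooted_rels S t n \<subseteq> open_rels S t n"
    proof clarify
      fix r assume r: "r \<in> rooted_rels S t n"
      then show "flip n r \<in> open_rels S t n"
        using flip_mem_rooted_rels_iff[OF flip_nc_equiv assms, of r S t]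
          flip_flip[OF rooted_rels_nc_equiv[OF r]] by simp
    qed
  qed
  then show ?thesis
    by (rule bij_betw_same_card[symmetric])
qed

section \<open>The last point as a second copy of the point 1\<close>

definition wrap :: "nat \<Rightarrow> nat \<Rightarrow> nat" where
  "wrap n x = (if x = Suc n then 1 else x)"

definition attach_last :: "nat \<Rightarrow> (nat \<times> nat) set \<Rightarrow> (nat \<times> nat) set" where
  "attach_last n r = {(x, y). x \<in> {1..Suc n} \<and> y \<in> {1..Suc n} \<and> (wrap n x, wrap n y) \<in> r}"

lemma wrap_in_range: "0 < n \<Longrightarrow> x \<in> {1..Suc n} \<Longrightarrow> wrap n x \<in> {1..n}"
  unfolding wrap_def by auto

lemma wrap_id: "x \<le> n \<Longrightarrow> wrap n x = x"
  unfolding wrap_def by simp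

lemma attach_last_nc_equiv:
  assumes r: "r \<in> nc_equiv n" and n: "0 < n"
  shows "attach_last n r \<in> nc_equiv (Suc n)"
proof (rule nc_equivI)
  show "(x, y) \<in> attach_last n r \<Longrightarrow> x \<in> {1..Suc n} \<and> y \<in> {1..Suc n}" for x y
    unfolding attach_last_def by blast
  show "x \<in> {1..Suc n} \<Longrightarrow> (x, x) \<in> attach_last n r" for x
    using nc_equiv_refl[OF r] wrap_in_range[OF n] unfolding attach_last_def by blast
  show "(x, y) \<in> attach_last n r \<Longrightarrow> (y, x) \<in> attach_last n r" for x y
    using nc_equiv_sym[OF r] unfolding attach_last_def by blast
  show "(x, y) \<in> attach_last n r \<Longrightarrow> (y, z) \<in> attach_last n r \<Longrightarrow> (x, z) \<in> attach_last n r"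
    for x y z
    using nc_equiv_trans[OF r, of "wrap n x" "wrap n y" "wrap n z"]
    unfolding attach_last_def by blast
  show "(i, j) \<in> attach_last n r" if ijkl: "i < j" "j < k" "k < l"
    and ik: "(i, k) \<in> attach_last n r" and jl: "(j, l) \<in> attach_last n r" for i j k l
  proof -
    have bounds: "1 \<le> i" "i \<le> n" "1 \<le> j" "j \<le> n" "k \<le> n" "l \<le> Suc n"
      using ijkl ik jl unfolding attach_last_def by auto
    have ik': "(i, k) \<in> r" and jl': "(j, wrap n l) \<in> r"
      using ik jl bounds unfolding attach_last_def by (auto simp: wrap_id)
    have "(i, j) \<in> r"
    proof (cases "l = Suc n")
      case False
      then show ?thesis
        using nc_equiv_nc[OF r ijkl ik'] jl' bounds by (simp add: wrap_def)
    next
      case True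
      \<comment> \<open>Replacing \<open>Suc n\<close> by 1 rotates the crossing: unless
        \<open>i = 1\<close>, the points become \<open>1 < i < j < k\<close> with pairs
        \<open>(1, j)\<close> and \<open>(i, k)\<close>.\<close>
      then have j1: "(j, 1) \<in> r"
        using jl' by (simp add: wrap_def)
      show ?thesis
      proof (cases "i = 1")
        case True
        then show ?thesis
          using nc_equiv_sym[OF r j1] by simp
      next
        case False
        then have "(1, i) \<in> r"
          using nc_equiv_nc[OF r _ ijkl(1,2) nc_equiv_sym[OF r j1] ik'] bounds by simp
        then show ?thesis
          using nc_equiv_trans[OF r j1] nc_equiv_sym[OF r] by blast
      qed
    qed
    then show ?thesis
      using bounds unfolding attach_last_def by (simp add: wrap_id)
  qed
qed

lemma left_part_attach_last:
  assumes r: "r \<in> nc_equiv n"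
  shows "left_part n (attach_last n r) = r"
  using nc_equiv_field[OF r] unfolding left_part_def attach_last_def
  by (fastforce simp: wrap_id)

lemma first_last_attach_last:
  assumes r: "r \<in> nc_equiv n" and n: "0 < n"
  shows "(1, Suc n) \<in> attach_last n r"
  using nc_equiv_refl[OF r, of 1] n unfolding attach_last_def wrap_def by auto

lemma attach_last_left_part:
  assumes q: "q \<in> nc_equiv (Suc n)" and n: "0 < n" and first_last: "(1, Suc n) \<in> q"
  shows "attach_last n (left_part n q) = q"
proof -
  have w: "(x, wrap n x) \<in> q" if "x \<in> {1..Suc n}" for x
    using that nc_equiv_refl[OF q, of x] nc_equiv_sym[OF q first_last] unfolding wrap_def by auto
  have "(wrap n x, wrap n y) \<in> left_part n q \<longleftrightarrow> (x, y) \<in> q"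
    if "x \<in> {1..Suc n}" "y \<in> {1..Suc n}" for x y
  proof -
    have "(wrap n x, wrap n y) \<in> left_part n q \<longleftrightarrow> (wrap n x, wrap n y) \<in> q"
      using wrap_in_range[OF n that(1)] wrap_in_range[OF n that(2)] unfolding left_part_def by simp
    also have "\<dots> \<longleftrightarrow> (x, y) \<in> q"
      using w[OF that(1)] w[OF that(2)] nc_equiv_trans[OF q] nc_equiv_sym[OF q] by metis
    finally show ?thesis .
  qed
  then show ?thesis
    using nc_equiv_field[OF q] unfolding attach_last_def by auto
qed

text \<open>Apply \<open>nc_equiv_bidual\<close> to the points 1 and \<open>n\<close>: no cut lies
  below 1, and \<open>n\<close> is the only cut not below \<open>n\<close>. So 1 and
  \<open>n\<close> are related exactly when no other cut is dual to \<open>n\<close>.\<close>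

lemma first_last_iff_dual_class:
  assumes q: "q \<in> nc_equiv n" and n: "0 < n"
  shows "(1, n) \<in> q \<longleftrightarrow> dual_rel n q `` {n} = {n}"
proof -
  note D = dual_rel_nc_equiv[of n q]
  have "1 \<in> {1..n}" "n \<in> {1..n}"
    using n by auto
  then have "(1, n) \<in> q \<longleftrightarrow> (\<forall>(u, v)\<in>dual_rel n q. (u < 1 \<longleftrightarrow> v < 1) \<longleftrightarrow> (u < n \<longleftrightarrow> v < n))"
    by (rule nc_equiv_bidual[OF q])
  also have "\<dots> \<longleftrightarrow> (\<forall>(u, v)\<in>dual_rel n q. u = n \<longleftrightarrow> v = n)"
    using dual_relD(1,2)[of _ _ n q] by (intro ball_cong refl) fastforce
  also have "\<dots> \<longleftrightarrow> dual_rel n q `` {n} = {n}"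
    using nc_equiv_refl[OF D \<open>n \<in> _\<close>] nc_equiv_sym[OF D] by blast
  finally show ?thesis .
qed

text \<open>The cuts \<open>x\<close> and \<open>y\<close> lie between the points 1 and
  \<open>Suc n\<close>, so a pair \<open>(Suc n, v)\<close> imposes on them the same condition as
  \<open>(1, v)\<close>, which survives in the left part.\<close>

lemma dual_rel_left_part:
  assumes q: "q \<in> nc_equiv (Suc n)" and first_last: "(1, Suc n) \<in> q"
    and x: "x \<in> {1..n}" and y: "y \<in> {1..n}"
  shows "(x, y) \<in> dual_rel (Suc n) q \<longleftrightarrow> (x, y) \<in> dual_rel n (left_part n q)"
proof
  assume dual: "(x, y) \<in> dual_rel (Suc n) q"
  show "(x, y) \<in> dual_rel n (left_part n q)"
    by (rule dual_relI[OF x y dual_relD(3)[OF dual]]) (simp add: left_part_def)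
next
  assume dual: "(x, y) \<in> dual_rel n (left_part n q)"
  have last: "x < v \<longleftrightarrow> y < v" if v: "(Suc n, v) \<in> q" "v \<le> n" for v
  proof -
    have "(1, v) \<in> left_part n q"
      using nc_equiv_trans[OF q first_last v(1)] v(2) x unfolding left_part_def by auto
    then show ?thesis
      using dual_relD(3)[OF dual] x y by fastforce
  qed
  show "(x, y) \<in> dual_rel (Suc n) q"
  proof (rule dual_relI)
    fix u v assume uv: "(u, v) \<in> q"
    note vu = nc_equiv_sym[OF q uv] and bounds = nc_equiv_field[OF q uv]
    consider "u \<le> n" "v \<le> n" | "u = Suc n" "v \<le> n" | "u \<le> n" "v = Suc n" | "u = Suc n" "v = Suc n"
      using bounds by force
    then show "(x < u \<longleftrightarrow> x < v) \<longleftrightarrow> (y < u \<longleftrightarrow> y < v)"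
    proof cases
      case 1
      then show ?thesis
        using dual_relD(3)[OF dual, of u v] uv unfolding left_part_def by simp
    next
      case 2
      then show ?thesis
        using last[of v] uv x y by auto
    next
      case 3
      then show ?thesis
        using last[of u] vu x y by auto
    qed simp
  qed (use x y in auto)
qed

text \<open>The class containing 1 and \<open>Suc n\<close> must have size \<open>d + 1\<close>, and
  loses one point. On the dual side only the singleton class of \<open>Suc n\<close>
  disappears.\<close>

lemma open_rels_1_Suc_iff:
  assumes q: "q \<in> nc_equiv (Suc n)" and n: "0 < n" and d: "1 \<le> d" and first_last: "(1, Suc n) \<in> q"
  shows "q \<in> open_rels {1, d + 1} 1 (Suc n) \<longleftrightarrow> left_part n q \<in> rooted_rels {1, d + 1} d n"
proof -
  define S where "S = {1, d + 1}"
  define r where "r = left_part n q"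
  have r: "r \<in> nc_equiv n"
    unfolding r_def by (rule left_part_nc_equiv[OF q]) simp
  have 1: "1 \<in> {1..n}"
    using n by simp
  have last: "dual_rel (Suc n) q `` {Suc n} = {Suc n}"
    using first_last_iff_dual_class[OF q] first_last by simp
  have last': "(x, Suc n) \<notin> dual_rel (Suc n) q" if "x \<in> {1..n}" for x
  proof
    assume "(x, Suc n) \<in> dual_rel (Suc n) q"
    then have "x \<in> dual_rel (Suc n) q `` {Suc n}"
      using nc_equiv_sym[OF dual_rel_nc_equiv] by blast
    then show False
      using last that by simp
  qed
  have dual_class: "dual_rel (Suc n) q `` {x} = dual_rel n r `` {x}" if x: "x \<in> {1..n}" for x
  proof -
    have "(x, y) \<in> dual_rel (Suc n) q \<longleftrightarrow> (x, y) \<in> dual_rel n r" for y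
    proof (cases "y \<in> {1..n}")
      case True
      then show ?thesis
        using dual_rel_left_part[OF q first_last x] unfolding r_def by blast
    next
      case False
      then show ?thesis
        using dual_relD(2)[of x y "Suc n" q] dual_relD(2)[of x y n r] last'[OF x]
        by (metis atLeastAtMost_iff le_SucE)
    qed
    then show ?thesis
      by blast
  qed
  have root_class: "q `` {x} = insert (Suc n) (r `` {1})" if x: "(1, x) \<in> q" for x
  proof -
    have "(x, y) \<in> q \<longleftrightarrow> (1, y) \<in> q" for y
      using x nc_equiv_trans[OF q] nc_equiv_sym[OF q] by blast
    then have "q `` {x} = q `` {1}"
      by blast
    also have "\<dots> = insert (Suc n) (r `` {1})"
      using first_last n nc_equiv_field[OF q] unfolding r_def left_part_def
      by (auto simp: le_Suc_eq)
    finally show ?thesis .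
  qed
  have card_root_class: "card (q `` {x}) = Suc (card (r `` {1}))" if x: "(1, x) \<in> q" for x
  proof -
    have "Suc n \<notin> r `` {1}"
      using nc_equiv_field[OF r, of 1 "Suc n"] by auto
    then show ?thesis
      unfolding root_class[OF x] using finite_class[OF r] by simp
  qed
  \<comment> \<open>Together with \<open>Suc n\<close> the root class has at least two elements,
    which rules out the size 1 in \<open>S\<close>.\<close>
  have pos: "0 < card (r `` {1})"
    using finite_class[OF r] nc_equiv_refl[OF r 1] by (auto simp: card_gt_0_iff)
  have other_class: "q `` {x} = r `` {x}" if x: "x \<in> {1..n}" "(1, x) \<notin> q" for x
  proof -
    have "(x, Suc n) \<notin> q"
      using x(2) first_last nc_equiv_trans[OF q] nc_equiv_sym[OF q] by blast
    then have "y \<le> n" if "(x, y) \<in> q" for y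
      using nc_equiv_field[OF q that] that by (metis atLeastAtMost_iff le_SucE)
    then show ?thesis
      using x(1) unfolding r_def left_part_def by auto
  qed
  have root_iff: "(x, 1) \<in> r \<longleftrightarrow> (1, x) \<in> q" if "x \<in> {1..n}" for x
    using that n nc_equiv_sym[OF q, of 1 x] nc_equiv_sym[OF q, of x 1]
    unfolding r_def left_part_def by auto
  have "(\<forall>x\<in>{1..Suc n}. card (q `` {x}) \<in> S) \<longleftrightarrow>
      card (r `` {1}) = d \<and> (\<forall>x\<in>{1..n}. (x, 1) \<notin> r \<longrightarrow> card (r `` {x}) \<in> S)"
    (is "?L \<longleftrightarrow> ?R")
  proof
    assume L: ?L
    have "card (q `` {Suc n}) \<in> S"
      using L by simp
    then have "card (r `` {1}) = d"
      using card_root_class[OF first_last] pos unfolding S_def by auto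
    moreover have "card (r `` {x}) \<in> S" if "x \<in> {1..n}" "(x, 1) \<notin> r" for x
    proof -
      have "card (q `` {x}) \<in> S"
        using L that(1) by simp
      then show ?thesis
        using other_class[OF that(1)] root_iff[OF that(1)] that(2) by simp
    qed
    ultimately show ?R
      by blast
  next
    assume R: ?R
    have "card (q `` {x}) \<in> S" if x: "x \<in> {1..Suc n}" for x
    proof (cases "(1, x) \<in> q")
      case True
      then show ?thesis
        using card_root_class R unfolding S_def by simp
    next
      case False
      then have "x \<noteq> Suc n"
        using first_last by blast
      then have "x \<in> {1..n}"
        using x by auto
      then show ?thesis
        using False R other_class root_iff by simp
    qed
    then show ?L
      by blast
  qed
  moreover have "card (dual_rel (Suc n) q `` {Suc n}) = 1"
    using last by simp
  moreover have "(\<forall>x\<in>{1..Suc n}. (x, Suc n) \<notin> dual_rel (Suc n) q \<longrightarrow>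
      card (dual_rel (Suc n) q `` {x}) \<in> S) \<longleftrightarrow> (\<forall>x\<in>{1..n}. card (dual_rel n r `` {x}) \<in> S)"
  proof -
    have "(Suc n, Suc n) \<in> dual_rel (Suc n) q"
      using nc_equiv_refl[OF dual_rel_nc_equiv] by simp
    moreover have "{1..Suc n} = insert (Suc n) {1..n}"
      by auto
    ultimately show ?thesis
      using dual_class last' by simp
  qed
  ultimately show ?thesis
    unfolding S_def[symmetric] r_def[symmetric] using q r
    by (simp only: open_rels_def rooted_rels_def mem_Collect_eq simp_thms conj_ac)
qed

text \<open>Indecomposability means that 1 and \<open>Suc n\<close> are related, so removing
  \<open>Suc n\<close> is reversible; \<open>flip\<close> then turns the root class of size
  \<open>d\<close> into a dual class of the last point. For \<open>n = 0\<close> the points 1 and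
  \<open>Suc n\<close> coincide, and that value is computed separately.\<close>

lemma card_open_rels_1_Suc:
  assumes n: "0 < n" and d: "1 \<le> d"
  shows "card (open_rels {1, d + 1} 1 (Suc n)) = card (open_rels {1, d + 1} d n)"
proof -
  have first_last: "(1, Suc n) \<in> q" if "q \<in> open_rels {1, d + 1} 1 (Suc n)" for q
    using first_last_iff_dual_class[OF open_rels_nc_equiv[OF that]]
      dual_class_open_rels_1[OF that] by simp
  have "bij_betw (left_part n) (open_rels {1, d + 1} 1 (Suc n)) (rooted_rels {1, d + 1} d n)"
  proof (rule bij_betw_byWitness[where f' = "attach_last n"])
    show "\<forall>q\<in>open_rels {1, d + 1} 1 (Suc n). attach_last n (left_part n q) = q"
      using attach_last_left_part[OF open_rels_nc_equiv n first_last] by blast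
    show "\<forall>r\<in>rooted_rels {1, d + 1} d n. left_part n (attach_last n r) = r"
      using left_part_attach_last[OF rooted_rels_nc_equiv] by blast
    show "left_part n ` open_rels {1, d + 1} 1 (Suc n) \<subseteq> rooted_rels {1, d + 1} d n"
      using open_rels_1_Suc_iff[OF open_rels_nc_equiv n d first_last] by blast
    show "attach_last n ` rooted_rels {1, d + 1} d n \<subseteq> open_rels {1, d + 1} 1 (Suc n)"
    proof clarify
      fix r assume r: "r \<in> rooted_rels {1, d + 1} d n"
      note r' = rooted_rels_nc_equiv[OF r]
      show "attach_last n r \<in> open_rels {1, d + 1} 1 (Suc n)"
        using open_rels_1_Suc_iff[OF attach_last_nc_equiv[OF r' n] n d
            first_last_attach_last[OF r' n]] left_part_attach_last[OF r'] r by simp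
    qed
  qed
  then show ?thesis
    using bij_betw_same_card card_rooted_rels[OF n] by metis
qed

section \<open>Counting\<close>

definition open_count :: "nat \<Rightarrow> nat \<Rightarrow> nat \<Rightarrow> nat" where
  "open_count d t n = card (open_rels {1, d + 1} t n)"

context
  fixes d :: nat
  assumes d: "1 \<le> d"
begin

section \<open>Boundary values and recurrence of the counts\<close>

lemma open_count_eq_0:
  assumes "n < t"
  shows "open_count d t n = 0"
proof -
  have "card (dual_rel n r `` {n}) \<le> n" for r
    using card_mono[of "{1..n}" "dual_rel n r `` {n}"] dual_relD(2)[of n _ n r] by fastforce
  then have "open_rels {1, d + 1} t n = {}"
    using assms unfolding open_rels_def by (auto simp: not_le[symmetric])
  then show ?thesis
    unfolding open_count_def by simp
qed

lemma open_count_0_pos: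
  assumes "0 < n"
  shows "open_count d 0 n = 0"
proof -
  have "card (dual_rel n r `` {n}) \<noteq> 0" for r
    using finite_class[OF dual_rel_nc_equiv] nc_equiv_refl[OF dual_rel_nc_equiv, of n n r] assms
    by (auto simp: card_eq_0_iff)
  then have "open_rels {1, d + 1} 0 n = {}"
    unfolding open_rels_def by auto
  then show ?thesis
    unfolding open_count_def by simp
qed

lemma open_count_0_0: "open_count d 0 0 = 1"
proof -
  have "nc_equiv 0 = {{}}"
  proof (intro equalityI subsetI)
    fix r assume "r \<in> nc_equiv 0"
    then show "r \<in> {{}}"
      using nc_equiv_field[of r 0] by auto
  next
    fix r :: "(nat \<times> nat) set" assume "r \<in> {{}}"
    then show "r \<in> nc_equiv 0"
      by (intro nc_equivI) auto
  qed
  moreover have "dual_rel 0 {} = {}"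
    unfolding dual_rel_def by auto
  ultimately have "open_rels {1, d + 1} 0 0 = {{}}"
    unfolding open_rels_def by auto
  then show ?thesis
    unfolding open_count_def by simp
qed

lemma open_count_1_1: "open_count d 1 1 = 1"
proof -
  have nc1: "nc_equiv 1 = {{(1, 1)}}"
  proof (intro equalityI subsetI)
    fix r assume r: "r \<in> nc_equiv 1"
    have "(x, y) \<in> r \<longleftrightarrow> x = 1 \<and> y = 1" for x y
      using nc_equiv_field[OF r, of x y] nc_equiv_refl[OF r, of 1] by auto
    then show "r \<in> {{(1, 1)}}"
      by auto
  next
    fix r :: "(nat \<times> nat) set" assume "r \<in> {{(1, 1)}}"
    then show "r \<in> nc_equiv 1"
      by (intro nc_equivI) auto
  qed
  have mem: "{(1, 1)} \<in> open_rels {1, d + 1} 1 1"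
  proof -
    have "dual_rel 1 {(1, 1)} = {(1, 1)}"
      unfolding dual_rel_def by auto
    moreover have "{(1, 1)} `` {1::nat} = {1::nat}" "{1..1::nat} = {1}"
      by auto
    ultimately show ?thesis
      unfolding open_rels_def mem_Collect_eq nc1 by (simp only:) simp
  qed
  have "open_rels {1, d + 1} 1 1 \<subseteq> {{(1, 1)}}"
    unfolding nc1[symmetric] by (rule subsetI) (rule open_rels_nc_equiv)
  then have "open_rels {1, d + 1} 1 1 = {{(1, 1)}}"
    using mem by (intro equalityI) (simp_all only: insert_subset empty_subsetI simp_thms)
  then show ?thesis
    unfolding open_count_def by (simp only: card.empty card.insert) simp
qed

text \<open>
  With \<open>F\<^sub>t\<close> the generating function of \<open>open_count d t\<close>, the direct sum decomposition gives
  \<open>F\<^sub>t = F\<^sub>1 ^ t\<close> and the removal of the last point gives \<open>F\<^sub>1 = X + X F\<^sub>d\<close>. Multiplying the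
  latter by \<open>F\<^sub>t\<close> yields the recurrence.
\<close>

lemma open_count_rec: "open_count d (Suc t) (Suc n) = open_count d t n + open_count d (t + d) n"
proof -
  define F :: "nat \<Rightarrow> real fps" where "F t = Abs_fps (\<lambda>n. real (open_count d t n))" for t
  have nth: "fps_nth (F t) n = real (open_count d t n)" for t n
    unfolding F_def by simp
  have F0: "F 0 = 1"
    by (rule fps_ext) (auto simp: nth open_count_0_0 open_count_0_pos)
  have FSuc: "F (Suc t) = F 1 * F t" for t
  proof (rule fps_ext)
    fix n
    have "fps_nth (F 1 * F t) n =
        (\<Sum>m=0..n. real (open_count d 1 m) * real (open_count d t (n - m)))"
      by (simp add: fps_mult_nth nth)
    \<comment> \<open>The term \<open>m = 0\<close> vanishes since
      \<open>open_count d 1 0 = 0\<close>, so the sum over nonempty first pieces is a full Cauchy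
      product.\<close>
    also have "\<dots> = (\<Sum>m=1..n. real (open_count d 1 m) * real (open_count d t (n - m)))"
      by (simp add: sum.atLeast_Suc_atMost open_count_eq_0)
    also have "\<dots> = real (open_count d (Suc t) n)"
      unfolding open_count_def card_open_rels_Suc[of _ t n] by simp
    finally show "fps_nth (F (Suc t)) n = fps_nth (F 1 * F t) n"
      by (simp add: nth)
  qed
  have F_power: "F t = F 1 ^ t" for t
    by (induction t) (simp_all only: F0 FSuc power_0 power_Suc)
  have F1: "F 1 = fps_X * (1 + F d)"
  proof (rule fps_ext)
    fix n
    \<comment> \<open>Degrees 0 and 1 are boundary values, where \<open>1 \<le> d\<close> ensures
      that \<open>F d\<close> has no constant term; removal of the last point covers the
      rest.\<close>
    consider "n = 0" | "n = 1" | m where "n = Suc m" "0 < m"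
      by (metis One_nat_def gr0_conv_Suc not_gr_zero)
    then show "fps_nth (F 1) n = fps_nth (fps_X * (1 + F d)) n"
    proof cases
      case 1
      then show ?thesis
        using open_count_eq_0[of 0 1] by (simp add: nth)
    next
      case 2
      then show ?thesis
        using open_count_1_1 open_count_eq_0[of 0 d] d by (simp add: nth)
    next
      case 3
      then show ?thesis
        using card_open_rels_1_Suc[OF 3(2) d] by (simp add: nth open_count_def)
    qed
  qed
  have "F (Suc t) = fps_X * (F t + F (t + d))"
  proof -
    have "F (Suc t) = fps_X * (1 + F d) * F t"
      by (simp only: FSuc F1)
    moreover have "F (t + d) = F t * F d"
      by (simp only: F_power[of "t + d"] F_power[of t] F_power[of d] power_add)
    ultimately show ?thesis
      by (simp only: algebra_simps mult_1_right)
  qed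
  then have "fps_nth (F (Suc t)) (Suc n) = fps_nth (F t + F (t + d)) n"
    by simp
  then show ?thesis
    unfolding fps_add_nth nth by linarith
qed

text \<open>Of the two terms of the recurrence, one keeps \<open>k\<close> and lowers
  \<open>t\<close>, the other lowers \<open>k\<close> and raises \<open>t\<close> by
  \<open>d - 1\<close>; hence an outer induction on \<open>k\<close> for all \<open>t\<close> and an
  inner one on \<open>t\<close>. Writing \<open>Suc t\<close> avoids the quotient 0/0 at
  \<open>t = k = 0\<close>.\<close>

lemma open_count_closed_form:
  "real (open_count d (Suc t) (d * k + Suc t)) =
     real (Suc t) / real (d * k + Suc t) * real ((d * k + Suc t) choose k)"
proof (induction k arbitrary: t)
  case 0
  \<comment> \<open>The second term of the recurrence vanishes because
    \<open>t < t + d\<close>.\<close>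
  have "open_count d t t = 1" for t
    by (induction t) (use d in \<open>simp_all add: open_count_0_0 open_count_rec open_count_eq_0\<close>)
  from this[of "Suc t"] show ?case
    by simp
next
  case (Suc k)
  note IH = Suc.IH
  show ?case
  proof (induction t)
    case 0
    define N where "N = d * Suc k"
    obtain d' where d': "d = Suc d'"
      using d by (cases d) auto
    have N: "0 < N" "N = d * k + Suc d'" "real N = real d * (real k + 1)"
      using d' by (simp_all add: N_def algebra_simps)
    \<comment> \<open>The term for \<open>t = 0\<close> vanishes as \<open>0 < N\<close>. Writing
      \<open>d = Suc d'\<close> gives the remaining one the shape of the outer hypothesis.\<close>
    have "open_count d 1 (Suc N) = open_count d (Suc d') N"
      using open_count_rec[of 0 N] open_count_0_pos[OF N(1)] d' by simp
    then have "real (open_count d 1 (Suc N)) = real d / real N * real (N choose k)"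
      using IH[of d'] d' unfolding N(2)[symmetric] by simp
    also have "\<dots> = real (N choose k) / real (Suc k)"
    proof -
      have "real d / real N = 1 / real (Suc k)"
        unfolding N(3) using d by (simp add: add.commute)
      then show ?thesis
        by simp
    qed
    also have "\<dots> = real (Suc N choose Suc k) / real (Suc N)"
    proof -
      have "real (Suc k) * real (Suc N choose Suc k) = real (Suc N) * real (N choose k)"
        unfolding of_nat_mult[symmetric] by (simp only: Suc_times_binomial)
      then show ?thesis
        by (simp add: field_simps del: binomial_Suc_Suc)
    qed
    finally show ?case
      unfolding N_def by simp
  next
    case (Suc t)
    define M where "M = d * Suc k + Suc t"
    define c where "c = real (M choose k)"
    define x where "x = real (M choose Suc k)"
    have "0 < M"
      by (simp add: M_def)
    then have M_pos: "0 < real M"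
      by simp
    \<comment> \<open>The first equation presents \<open>M\<close> in the form needed for the outer
      hypothesis, with one \<open>d\<close> moved from the multiple into the offset.\<close>
    have M: "M = d * k + Suc (t + d)"
      "real M = real d * (real k + 1) + real t + 1"
      by (simp_all add: M_def algebra_simps)
    have "real (Suc k) * real (Suc M choose Suc k) = real (Suc M) * real (M choose k)"
      unfolding of_nat_mult[symmetric] by (simp only: Suc_times_binomial)
    \<comment> \<open>By Pascal's rule \<open>c + x\<close> is the binomial coefficient of the goal,
      so absorption expresses it through \<open>c\<close>.\<close>
    then have absorb: "(real k + 1) * (c + x) = (real M + 1) * c"
      unfolding c_def x_def by (simp add: algebra_simps)
    have "open_count d (Suc (Suc t)) (Suc M) = open_count d (Suc t) M + open_count d (Suc (t + d)) M"
      using open_count_rec[of "Suc t" M] by simp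
    then have "real (open_count d (Suc (Suc t)) (Suc M)) =
        real (Suc t) / real M * x + real (Suc (t + d)) / real M * c"
      using Suc.IH IH[of "t + d"] unfolding M_def[symmetric] M(1)[symmetric]
      by (simp add: c_def x_def)
    also have "\<dots> = real (Suc (Suc t)) / real (Suc M) * (c + x)"
    proof -
      let ?K = "real k + 1" and ?t = "real t + 1"
      \<comment> \<open>Multiplying by \<open>?K\<close> lets \<open>absorb\<close> eliminate
        \<open>x\<close>; then \<open>real M = real d * ?K + ?t\<close> collects the terms into a
        multiple of \<open>real M\<close>.\<close>
      have "?K * (?t * x + (?t + real d) * c) = ?t * (?K * (c + x)) + real d * ?K * c"
        by (simp add: algebra_simps)
      also have "\<dots> = (?t + 1) * real M * c"
        unfolding absorb by (simp add: M(2) algebra_simps)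
      finally have "?t * x + (?t + real d) * c = (?t + 1) * real M * c / ?K"
        by (simp add: field_simps)
      moreover have "c + x = (real M + 1) * c / ?K"
        using absorb by (simp add: field_simps)
      moreover have "real (Suc t) / real M * x + real (Suc (t + d)) / real M * c =
          (?t * x + (?t + real d) * c) / real M"
        by (simp add: add_divide_distrib algebra_simps)
      ultimately show ?thesis
        using M_pos by (simp add: add.commute)
    qed
    also have "c + x = real (Suc M choose Suc k)"
      unfolding c_def x_def by simp
    finally show ?case
      unfolding M_def by simp
  qed
qed

end

section \<open>The two counts of noncrossing partitions\<close>

theorem theorem4p5:
  fixes d k :: nat
  assumes "d \<ge> 1"
  shows "real (card {P \<in> noncrossing_partitions (d * k + 1).
                 (\<forall>B\<in>P. card B = 1 \<or> card B = d + 1) \<and>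
                 (\<forall>B\<in>kreweras_dual (d * k + 1) P. card B = 1 \<or> card B = d + 1)})
           = 2 / real (d * k + 2) * real ((d * k + 2) choose k)
       \<and> real (card {P \<in> noncrossing_partitions (d * k + 1).
                 (\<forall>B\<in>P. card B = 1 \<or> card B = d + 1) \<and>
                 (\<forall>B\<in>kreweras_dual (d * k + 1) P. card B = 1 \<or> card B = d + 1) \<and>
                 {1} \<in> P})
           = 1 / real (d * k + 1) * real ((d * k + 1) choose k)"
proof -
  define n where "n = d * k + 1"
  define S where "S = {1, d + 1}"
  define R where "R = {r \<in> nc_equiv n. (\<forall>x\<in>{1..n}. card (r `` {x}) \<in> S) \<and>
    (\<forall>x\<in>{1..n}. card (dual_rel n r `` {x}) \<in> S)}"
  have n: "0 < n" "1 \<in> {1..n}" "n \<in> {1..n}"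
    unfolding n_def by simp_all
  \<comment> \<open>The predicate \<open>Q\<close> lets one transfer from partitions to relations
    serve both counts, with and without the block \<open>{1}\<close>.\<close>
  have card_image_R: "card {P \<in> noncrossing_partitions n. (\<forall>B\<in>P. card B = 1 \<or> card B = d + 1) \<and>
      (\<forall>B\<in>kreweras_dual n P. card B = 1 \<or> card B = d + 1) \<and> Q P} =
      card {r \<in> R. Q ({1..n} // r)}" (is "card ?P = card ?R") for Q
  proof -
    have inj: "inj_on (\<lambda>r. {1..n} // r) (nc_equiv n)"
      and image: "(\<lambda>r. {1..n} // r) ` nc_equiv n = noncrossing_partitions n"
      using bij_betw_nc_equiv[of n] unfolding bij_betw_def by auto
    have blocks: "(\<forall>B\<in>{1..n} // r. card B = 1 \<or> card B = d + 1) \<longleftrightarrow>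
        (\<forall>x\<in>{1..n}. card (r `` {x}) \<in> S)" for r
      unfolding quotient_def S_def by simp
    define G where "G P \<longleftrightarrow> (\<forall>B\<in>P. card B = 1 \<or> card B = d + 1) \<and>
      (\<forall>B\<in>kreweras_dual n P. card B = 1 \<or> card B = d + 1) \<and> Q P" for P
    have "G ({1..n} // r) \<longleftrightarrow> r \<in> R \<and> Q ({1..n} // r)" if "r \<in> nc_equiv n" for r
      using that by (simp only: G_def R_def kreweras_dual_quotient blocks mem_Collect_eq
          simp_thms conj_assoc)
    moreover have "R \<subseteq> nc_equiv n"
      unfolding R_def by blast
    ultimately have "?P = (\<lambda>r. {1..n} // r) ` ?R"
      unfolding image[symmetric] G_def[symmetric] by blast
    moreover have "inj_on (\<lambda>r. {1..n} // r) ?R"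
      using inj by (rule inj_on_subset) (auto simp: R_def)
    ultimately show ?thesis
      by (simp add: card_image)
  qed
  \<comment> \<open>Split by the size of the dual class of \<open>n\<close>. All cuts dual to
    \<open>n\<close> share this class, so its size settles the constraint at each of them.\<close>
  have "R = open_rels S 1 n \<union> open_rels S (d + 1) n"
  proof (intro equalityI subsetI)
    fix r assume "r \<in> R"
    then show "r \<in> open_rels S 1 n \<union> open_rels S (d + 1) n"
      using n(3) unfolding R_def open_rels_def S_def by simp
  next
    fix r assume r: "r \<in> open_rels S 1 n \<union> open_rels S (d + 1) n"
    have "card (dual_rel n r `` {x}) \<in> S" if x: "x \<in> {1..n}" for x
    proof (cases "(x, n) \<in> dual_rel n r")
      case True
      have "equiv {1..n} (dual_rel n r)"
        using dual_rel_nc_equiv unfolding nc_equiv_def by simp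
      from equiv_class_eq[OF this True] show ?thesis
        using r unfolding open_rels_def S_def by auto
    next
      case False
      then show ?thesis
        using r x unfolding open_rels_def by blast
    qed
    then show "r \<in> R"
      using r unfolding R_def open_rels_def by blast
  qed
  moreover have "open_rels S 1 n \<inter> open_rels S (d + 1) n = {}"
    using assms unfolding open_rels_def by auto
  ultimately have "card R = open_count d 1 n + open_count d (1 + d) n"
    using card_Un_disjoint[OF finite_open_rels finite_open_rels] unfolding open_count_def S_def
    by simp
  \<comment> \<open>The recurrence with \<open>t = 1\<close>, read from right to left, merges the
    two cases into one count on \<open>Suc n\<close> points.\<close>
  also have "\<dots> = open_count d 2 (Suc n)"
    using open_count_rec[OF assms, of 1 n] by (simp add: numeral_2_eq_2)
  finally have 1: "real (card R) = 2 / real (d * k + 2) * real ((d * k + 2) choose k)"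
    using open_count_closed_form[OF assms, of 1 k] by (simp add: n_def numeral_2_eq_2)
  \<comment> \<open>The block \<open>{1}\<close> fixes the size of the root class to 1, a member of
    \<open>S\<close>; \<open>flip\<close> then identifies the count with that for
    \<open>t = 1\<close>.\<close>
  have "{r \<in> R. {1} \<in> {1..n} // r} = rooted_rels S 1 n"
  proof -
    have iff: "{1} \<in> {1..n} // r \<longleftrightarrow> card (r `` {1}) = 1" if r: "r \<in> nc_equiv n" for r
    proof
      assume "{1} \<in> {1..n} // r"
      then obtain x where x: "{1} = r `` {x}"
        by (rule quotientE)
      then have "(x, 1) \<in> r" "(x, x) \<in> r"
        using nc_equiv_refl[OF r] nc_equiv_field[OF r, of x 1] by blast+
      then have "x = 1"
        using x by blast
      then show "card (r `` {1}) = 1"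
        using x by simp
    next
      assume "card (r `` {1}) = 1"
      moreover have "1 \<in> r `` {1}"
        using nc_equiv_refl[OF r n(2)] by simp
      ultimately have "r `` {1} = {1}"
        by (metis card_1_singletonE singletonD)
      then show "{1} \<in> {1..n} // r"
        using quotientI[OF n(2), of r] by simp
    qed
    have root: "card (r `` {x}) = card (r `` {1})" if "r \<in> nc_equiv n" "(x, 1) \<in> r" for r x
      using that equiv_class_eq[of "{1..n}" r x 1] unfolding nc_equiv_def by simp
    show ?thesis
    proof (intro equalityI subsetI)
      fix r assume "r \<in> {r \<in> R. {1} \<in> {1..n} // r}"
      then show "r \<in> rooted_rels S 1 n"
        using iff unfolding R_def rooted_rels_def by blast
    next
      fix r assume r: "r \<in> rooted_rels S 1 n"
      have "card (r `` {x}) \<in> S" if x: "x \<in> {1..n}" for x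
      proof (cases "(x, 1) \<in> r")
        case True
        then show ?thesis
          using root[OF rooted_rels_nc_equiv[OF r]] r unfolding rooted_rels_def S_def by simp
      next
        case False
        then show ?thesis
          using r x unfolding rooted_rels_def by blast
      qed
      then show "r \<in> {r \<in> R. {1} \<in> {1..n} // r}"
        using r iff unfolding R_def rooted_rels_def by blast
    qed
  qed
  then have "card {r \<in> R. {1} \<in> {1..n} // r} = open_count d 1 n"
    using card_rooted_rels[OF n(1)] unfolding open_count_def S_def by simp
  then have 2: "real (card {r \<in> R. {1} \<in> {1..n} // r}) =
      1 / real (d * k + 1) * real ((d * k + 1) choose k)"
    using open_count_closed_form[OF assms, of 0 k] by (simp add: n_def)
  show ?thesis
    using 1 2 card_image_R[of "\<lambda>P. True"] card_image_R[of "\<lambda>P. {1} \<in> P"]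
    unfolding n_def by simp
qed

end
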